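(* Let $R$ be an arithmetic ring which is self fp-injective. Then $\lambda\text{-}\dim(R)\le 2$.
   Context: All rings are commutative with identity. $R$ is arithmetic if $R_M$ is a valuation ring (ideals totally ordered by inclusion) for every maximal ideal $M$. An $R$-module $E$ is fp-injective if $\mathrm{Ext}^1_R(F,E)=0$ for every finitely presented $R$-module $F$; $R$ is self fp-injective if $R$ is fp-injective as an $R$-module. For an $R$-module $E$, $\lambda_R(E)$ is the supremum of the $n$ for which there is an exact sequence $F_n\to\cdots\to F_0\to E\to0$ with $F_i$ free of finite rank ($-1$ if $E$ is not finitely generated); $\lambda\text{-}\dim(R)$ is the least $n$ (or $\infty$) such that $\lambda_R(E)\ge n$ implies $\lambda_R(E)=\infty$ for all $E$. *)

theory Defs
  imports "HOL-Algebra.Algebra" "HOL-Library.Extended_Real"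
begin

definition loc_rel :: "'a ring \<Rightarrow> 'a set \<Rightarrow> (('a \<times> 'a) \<times> ('a \<times> 'a)) set" where
  "loc_rel R S = {((r, s), (r', s')). r \<in> carrier R \<and> s \<in> S \<and> r' \<in> carrier R \<and> s' \<in> S \<and>
      (\<exists>t\<in>S. t \<otimes>\<^bsub>R\<^esub> ((r \<otimes>\<^bsub>R\<^esub> s') \<ominus>\<^bsub>R\<^esub> (r' \<otimes>\<^bsub>R\<^esub> s)) = \<zero>\<^bsub>R\<^esub>)}"

definition localization :: "'a ring \<Rightarrow> 'a set \<Rightarrow> ('a \<times> 'a) set ring" where
  "localization R S =
     \<lparr> carrier = (carrier R \<times> S) // loc_rel R S,
       monoid.mult = (\<lambda>A B. {z. \<exists>r s r' s'. (r, s) \<in> A \<and> (r', s') \<in> B \<and>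
                          (z, (r \<otimes>\<^bsub>R\<^esub> r', s \<otimes>\<^bsub>R\<^esub> s')) \<in> loc_rel R S}),
       one = loc_rel R S `` {(\<one>\<^bsub>R\<^esub>, \<one>\<^bsub>R\<^esub>)},
       ring.zero = loc_rel R S `` {(\<zero>\<^bsub>R\<^esub>, \<one>\<^bsub>R\<^esub>)},
       ring.add = (\<lambda>A B. {z. \<exists>r s r' s'. (r, s) \<in> A \<and> (r', s') \<in> B \<and>
                          (z, ((r \<otimes>\<^bsub>R\<^esub> s') \<oplus>\<^bsub>R\<^esub> (r' \<otimes>\<^bsub>R\<^esub> s), s \<otimes>\<^bsub>R\<^esub> s')) \<in> loc_rel R S}) \<rparr>"

definition localization_at :: "'a ring \<Rightarrow> 'a set \<Rightarrow> ('a \<times> 'a) set ring" where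
  "localization_at R P = localization R (carrier R - P)"

definition valuation_ring :: "('b, 'c) ring_scheme \<Rightarrow> bool" where
  "valuation_ring A \<longleftrightarrow> (\<forall>I J. ideal I A \<and> ideal J A \<longrightarrow> I \<subseteq> J \<or> J \<subseteq> I)"

definition arithmetic_ring :: "'a ring \<Rightarrow> bool" where
  "arithmetic_ring R \<longleftrightarrow> cring R \<and>
     (\<forall>M. maximalideal M R \<longrightarrow> valuation_ring (localization_at R M))"

definition linear_map :: "'a ring \<Rightarrow> ('a, 'm) module \<Rightarrow> ('a, 'n) module \<Rightarrow> ('m \<Rightarrow> 'n) \<Rightarrow> bool" where
  "linear_map R M N f \<longleftrightarrow> f \<in> carrier M \<rightarrow> carrier N \<and>
     (\<forall>x\<in>carrier M. \<forall>y\<in>carrier M. f (x \<oplus>\<^bsub>M\<^esub> y) = f x \<oplus>\<^bsub>N\<^esub> f y) \<and>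
     (\<forall>a\<in>carrier R. \<forall>x\<in>carrier M. f (a \<odot>\<^bsub>M\<^esub> x) = a \<odot>\<^bsub>N\<^esub> f x)"

definition lin_kernel :: "('a, 'm) module \<Rightarrow> ('a, 'n) module \<Rightarrow> ('m \<Rightarrow> 'n) \<Rightarrow> 'm set" where
  "lin_kernel M N f = {x \<in> carrier M. f x = \<zero>\<^bsub>N\<^esub>}"

definition free_module :: "'a ring \<Rightarrow> nat \<Rightarrow> ('a, nat \<Rightarrow> 'a) module" where
  "free_module R k =
     \<lparr> carrier = {v. (\<forall>i<k. v i \<in> carrier R) \<and> (\<forall>i\<ge>k. v i = \<zero>\<^bsub>R\<^esub>)},
       monoid.mult = (\<lambda>v w i. \<zero>\<^bsub>R\<^esub>),
       one = (\<lambda>i. \<zero>\<^bsub>R\<^esub>),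
       ring.zero = (\<lambda>i. \<zero>\<^bsub>R\<^esub>),
       ring.add = (\<lambda>v w i. v i \<oplus>\<^bsub>R\<^esub> w i),
       module.smult = (\<lambda>a v i. a \<otimes>\<^bsub>R\<^esub> v i) \<rparr>"

definition self_module :: "'a ring \<Rightarrow> ('a, 'a) module" where
  "self_module R =
     \<lparr> carrier = carrier R, monoid.mult = (\<lambda>x y. x \<otimes>\<^bsub>R\<^esub> y), one = \<one>\<^bsub>R\<^esub>,
       ring.zero = \<zero>\<^bsub>R\<^esub>, ring.add = (\<lambda>x y. x \<oplus>\<^bsub>R\<^esub> y),
       module.smult = (\<lambda>x y. x \<otimes>\<^bsub>R\<^esub> y) \<rparr>"

definition has_partial_resolution :: "'a ring \<Rightarrow> ('a, 'm) module \<Rightarrow> nat \<Rightarrow> bool" where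
  "has_partial_resolution R E n \<longleftrightarrow>
     (\<exists>(k :: nat \<Rightarrow> nat) (d0 :: (nat \<Rightarrow> 'a) \<Rightarrow> 'm) (d :: nat \<Rightarrow> (nat \<Rightarrow> 'a) \<Rightarrow> (nat \<Rightarrow> 'a)).
        linear_map R (free_module R (k 0)) E d0 \<and>
        d0 ` carrier (free_module R (k 0)) = carrier E \<and>
        (\<forall>i\<in>{1..n}. linear_map R (free_module R (k i)) (free_module R (k (i - 1))) (d i)) \<and>
        (1 \<le> n \<longrightarrow> d 1 ` carrier (free_module R (k 1)) = lin_kernel (free_module R (k 0)) E d0) \<and>
        (\<forall>i\<in>{1..<n}. d (i + 1) ` carrier (free_module R (k (i + 1))) =
                       lin_kernel (free_module R (k i)) (free_module R (k (i - 1))) (d i)))"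

text \<open>lambda_R(E): supremum of the n admitting such a sequence; -1 if there is none
  (i.e. E is not finitely generated).\<close>
definition lambda_inv :: "'a ring \<Rightarrow> ('a, 'm) module \<Rightarrow> ereal" where
  "lambda_inv R E = Sup ({-1} \<union> {ereal (real n) | n. has_partial_resolution R E n})"

definition finitely_presented :: "'a ring \<Rightarrow> ('a, 'm) module \<Rightarrow> bool" where
  "finitely_presented R F \<longleftrightarrow> has_partial_resolution R F 1"

text \<open>Ext^1_R(F,E) = 0, in Yoneda form: every short exact sequence 0 -> E -> X -> F -> 0
  splits. Every such extension X is isomorphic to one whose underlying set is a subset
  of carrier E \<times> carrier F, so X may be taken on the type 'e \<times> 'f.\<close>
definition Ext1_vanishes :: "'a ring \<Rightarrow> ('a, 'f) module \<Rightarrow> ('a, 'e) module \<Rightarrow> bool" where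
  "Ext1_vanishes R F E \<longleftrightarrow>
     (\<forall>(Xm :: ('a, 'e \<times> 'f) module) (i :: 'e \<Rightarrow> 'e \<times> 'f) (p :: 'e \<times> 'f \<Rightarrow> 'f).
        module R Xm \<and> linear_map R E Xm i \<and> inj_on i (carrier E) \<and>
        linear_map R Xm F p \<and> p ` carrier Xm = carrier F \<and>
        i ` carrier E = lin_kernel Xm F p
        \<longrightarrow> (\<exists>s. linear_map R F Xm s \<and> (\<forall>y\<in>carrier F. p (s y) = y)))"

text \<open>fp-injective: Ext^1(F,E) = 0 for every finitely presented F. A finitely presented
  module is a quotient of some R^n, whose carrier is a subset of the type nat => 'a;
  hence every finitely presented module is isomorphic to one on that type.\<close>
definition fp_injective :: "'a ring \<Rightarrow> ('a, 'e) module \<Rightarrow> bool" where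
  "fp_injective R E \<longleftrightarrow>
     (\<forall>F :: ('a, nat \<Rightarrow> 'a) module. module R F \<and> finitely_presented R F \<longrightarrow> Ext1_vanishes R F E)"

definition self_fp_injective :: "'a ring \<Rightarrow> bool" where
  "self_fp_injective R \<longleftrightarrow> fp_injective R (self_module R)"

end

theory Submission
  imports Defs
begin

text \<open>Let \<open>F\<^sub>n \<rightarrow> F\<^sub>n\<^sub>-\<^sub>1 \<rightarrow> F\<^sub>n\<^sub>-\<^sub>2\<close> be exact with \<open>n \<ge> 2\<close>, given by matrices \<open>B\<close> and \<open>A\<close>.
  Self fp-injectivity says that every functional on \<open>F\<^sub>n\<^sub>-\<^sub>1\<close> vanishing on \<open>ker A\<close> factors through
  \<open>A\<close>, so the kernel of the transpose of \<open>B\<close> is the row space of \<open>A\<close>, which is finitely generated.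
  Over an arithmetic ring the kernel of a matrix is finitely generated iff that of its transpose
  is: near each maximal ideal one entry divides all the others, and Gaussian elimination reduces
  the matrix to a diagonal one, for which both kernels are built from the annihilators of the
  diagonal entries. Hence \<open>ker B\<close> is finitely generated and the resolution extends by one step.
  Modules are not localized; a denominator outside the maximal ideal is carried along instead.\<close>

section \<open>Linear maps\<close>

lemma linear_mapI:
  assumes "\<And>x. x \<in> carrier M \<Longrightarrow> f x \<in> carrier N"
    and "\<And>x y. \<lbrakk>x \<in> carrier M; y \<in> carrier M\<rbrakk> \<Longrightarrow> f (x \<oplus>\<^bsub>M\<^esub> y) = f x \<oplus>\<^bsub>N\<^esub> f y"
    and "\<And>a x. \<lbrakk>a \<in> carrier R; x \<in> carrier M\<rbrakk> \<Longrightarrow> f (a \<odot>\<^bsub>M\<^esub> x) = a \<odot>\<^bsub>N\<^esub> f x"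
  shows "linear_map R M N f"
  using assms by (auto simp: linear_map_def)

lemma linear_mapD:
  assumes "linear_map R M N f"
  shows linear_map_closed: "x \<in> carrier M \<Longrightarrow> f x \<in> carrier N"
    and linear_map_add: "\<lbrakk>x \<in> carrier M; y \<in> carrier M\<rbrakk> \<Longrightarrow> f (x \<oplus>\<^bsub>M\<^esub> y) = f x \<oplus>\<^bsub>N\<^esub> f y"
    and linear_map_smult: "\<lbrakk>a \<in> carrier R; x \<in> carrier M\<rbrakk> \<Longrightarrow> f (a \<odot>\<^bsub>M\<^esub> x) = a \<odot>\<^bsub>N\<^esub> f x"
  using assms by (auto simp: linear_map_def)

lemma linear_map_abelian_group_hom:
  assumes "module R M" "module R N" "linear_map R M N f"
  shows "abelian_group_hom M N f"
proof -
  interpret M: module R M by fact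
  interpret N: module R N by fact
  show ?thesis
    using linear_mapD[OF assms(3)]
    by (intro abelian_group_homI M.abelian_group_axioms N.abelian_group_axioms group_hom.intro
        group_hom_axioms.intro M.a_group N.a_group homI) auto
qed

lemmas linear_map_zero = abelian_group_hom.hom_zero[OF linear_map_abelian_group_hom]
  and linear_map_neg = abelian_group_hom.hom_a_inv[OF linear_map_abelian_group_hom]

lemma linear_map_compose:
  assumes "linear_map R L M f" "linear_map R M N g"
  shows "linear_map R L N (\<lambda>x. g (f x))"
  by (rule linear_mapI) (simp_all add: linear_mapD[OF assms(1)] linear_mapD[OF assms(2)])

lemma linear_map_sum:
  assumes "module R N" "linear_map R M N f" "linear_map R M N g"
  shows "linear_map R M N (\<lambda>x. f x \<oplus>\<^bsub>N\<^esub> g x)"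
proof -
  interpret N: module R N by fact
  show ?thesis
    by (rule linear_mapI)
      (simp_all add: linear_mapD[OF assms(2)] linear_mapD[OF assms(3)] N.smult_r_distr N.a_ac)
qed

lemma linear_map_diff:
  assumes "module R N" "linear_map R M N f" "linear_map R M N g"
  shows "linear_map R M N (\<lambda>x. f x \<ominus>\<^bsub>N\<^esub> g x)"
proof -
  interpret N: module R N by fact
  have "linear_map R M N (\<lambda>x. \<ominus>\<^bsub>N\<^esub> g x)"
    by (rule linear_mapI) (simp_all add: linear_mapD[OF assms(3)] N.minus_add N.smult_r_minus)
  then show ?thesis
    unfolding a_minus_def by (rule linear_map_sum[OF assms(1,2)])
qed

lemma submodule_linear_image:
  assumes "module R M" "module R N" "linear_map R M N f"
  shows "submodule (f ` carrier M) R N"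
proof -
  interpret M: module R M by fact
  interpret N: module R N by fact
  interpret f: abelian_group_hom M N f by (rule linear_map_abelian_group_hom[OF assms])
  show ?thesis
  proof (rule N.submoduleI)
    show "\<zero>\<^bsub>N\<^esub> \<in> f ` carrier M"
      using f.hom_zero by (metis imageI M.zero_closed)
  next
    fix y assume "y \<in> f ` carrier M"
    then show "\<ominus>\<^bsub>N\<^esub> y \<in> f ` carrier M"
      by (auto simp flip: f.hom_a_inv)
  next
    fix y z assume "y \<in> f ` carrier M" "z \<in> f ` carrier M"
    then show "y \<oplus>\<^bsub>N\<^esub> z \<in> f ` carrier M"
      by (auto simp flip: f.hom_add)
  next
    fix a y assume "a \<in> carrier R" "y \<in> f ` carrier M"
    then show "a \<odot>\<^bsub>N\<^esub> y \<in> f ` carrier M"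
      by (auto simp flip: linear_map_smult[OF assms(3)])
  qed auto
qed

lemma submodule_lin_kernel:
  assumes "module R M" "module R N" "linear_map R M N f"
  shows "submodule (lin_kernel M N f) R M"
proof -
  interpret M: module R M by fact
  interpret N: module R N by fact
  interpret f: abelian_group_hom M N f by (rule linear_map_abelian_group_hom[OF assms])
  show ?thesis
    by (rule M.submoduleI) (auto simp: lin_kernel_def linear_map_smult[OF assms(3)])
qed

definition kernel_module :: "('a, 'm) module \<Rightarrow> ('a, 'n) module \<Rightarrow> ('m \<Rightarrow> 'n) \<Rightarrow> ('a, 'm) module" where
  "kernel_module M N f = M\<lparr>carrier := lin_kernel M N f\<rparr>"

lemma kernel_module_simps [simp]:
  "carrier (kernel_module M N f) = lin_kernel M N f"
  "add (kernel_module M N f) = add M" "smult (kernel_module M N f) = smult M"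
  by (simp_all add: kernel_module_def)

lemma module_kernel_module:
  assumes "module R M" "module R N" "linear_map R M N f"
  shows "module R (kernel_module M N f)"
  unfolding kernel_module_def
  by (rule submodule.submodule_is_module[OF submodule_lin_kernel[OF assms] assms(1)])

lemma abelian_group_of_surj_linear_map:
  assumes "module R P" "linear_map R P Q f" "f ` carrier P = carrier Q" "f \<zero>\<^bsub>P\<^esub> = \<zero>\<^bsub>Q\<^esub>"
  shows "abelian_group Q"
proof (rule abelian_groupI)
  interpret P: module R P by fact
  note add = linear_map_add[OF assms(2), symmetric]
  have lift: "\<exists>u\<in>carrier P. x = f u" if "x \<in> carrier Q" for x
    using that assms(3) by blast
  note closed = linear_map_closed[OF assms(2)]
  show "\<zero>\<^bsub>Q\<^esub> \<in> carrier Q" using closed assms(4) P.zero_closed by metis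
  fix x assume "x \<in> carrier Q"
  then obtain u where u: "u \<in> carrier P" "x = f u" using lift by blast
  show "\<zero>\<^bsub>Q\<^esub> \<oplus>\<^bsub>Q\<^esub> x = x" using u by (simp flip: assms(4) add: add)
  have "f (\<ominus>\<^bsub>P\<^esub> u) \<oplus>\<^bsub>Q\<^esub> x = \<zero>\<^bsub>Q\<^esub>" using u by (simp flip: assms(4) add: add P.l_neg)
  then show "\<exists>y\<in>carrier Q. y \<oplus>\<^bsub>Q\<^esub> x = \<zero>\<^bsub>Q\<^esub>" using closed u by blast
  fix y assume "y \<in> carrier Q"
  then obtain v where v: "v \<in> carrier P" "y = f v" using lift by blast
  show "x \<oplus>\<^bsub>Q\<^esub> y \<in> carrier Q" using u v closed by (simp add: add)
  show "x \<oplus>\<^bsub>Q\<^esub> y = y \<oplus>\<^bsub>Q\<^esub> x" using u v by (simp add: add P.a_comm)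
  fix z assume "z \<in> carrier Q"
  then obtain w where "w \<in> carrier P" "z = f w" using lift by blast
  then show "x \<oplus>\<^bsub>Q\<^esub> y \<oplus>\<^bsub>Q\<^esub> z = x \<oplus>\<^bsub>Q\<^esub> (y \<oplus>\<^bsub>Q\<^esub> z)"
    using u v by (simp add: add P.a_assoc)
qed

lemma module_of_surj_linear_map:
  assumes "module R P" "linear_map R P Q f" "f ` carrier P = carrier Q" "f \<zero>\<^bsub>P\<^esub> = \<zero>\<^bsub>Q\<^esub>"
  shows "module R Q"
proof (rule moduleI)
  interpret P: module R P by fact
  show "cring R" by (rule P.R.is_cring)
  show "abelian_group Q" using assms by (rule abelian_group_of_surj_linear_map)
  note lin = linear_mapD(2,3)[OF assms(2), symmetric]
  have lift: "\<exists>u\<in>carrier P. x = f u" if "x \<in> carrier Q" for x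
    using that assms(3) by blast
  fix x assume "x \<in> carrier Q"
  then obtain u where u: "u \<in> carrier P" "x = f u" using lift by blast
  show "\<one>\<^bsub>R\<^esub> \<odot>\<^bsub>Q\<^esub> x = x" using u by (simp add: lin)
  fix a assume a: "a \<in> carrier R"
  show "a \<odot>\<^bsub>Q\<^esub> x \<in> carrier Q" using u a linear_map_closed[OF assms(2)] by (simp add: lin)
  show "a \<odot>\<^bsub>Q\<^esub> (x \<oplus>\<^bsub>Q\<^esub> y) = a \<odot>\<^bsub>Q\<^esub> x \<oplus>\<^bsub>Q\<^esub> a \<odot>\<^bsub>Q\<^esub> y" if "y \<in> carrier Q" for y
    using lift[OF that] u a by (auto simp: lin P.smult_r_distr)
  fix b assume b: "b \<in> carrier R"
  show "(a \<oplus>\<^bsub>R\<^esub> b) \<odot>\<^bsub>Q\<^esub> x = a \<odot>\<^bsub>Q\<^esub> x \<oplus>\<^bsub>Q\<^esub> b \<odot>\<^bsub>Q\<^esub> x"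
    using u a b by (simp add: lin P.smult_l_distr)
  show "(a \<otimes>\<^bsub>R\<^esub> b) \<odot>\<^bsub>Q\<^esub> x = a \<odot>\<^bsub>Q\<^esub> (b \<odot>\<^bsub>Q\<^esub> x)"
    using u a b by (simp add: lin P.smult_assoc1)
qed

definition prod_module :: "('a, 'm) module \<Rightarrow> ('a, 'n) module \<Rightarrow> ('a, 'm \<times> 'n) module" where
  "prod_module M N =
     \<lparr> carrier = carrier M \<times> carrier N,
       monoid.mult = (\<lambda>x y. x), one = (\<zero>\<^bsub>M\<^esub>, \<zero>\<^bsub>N\<^esub>),
       ring.zero = (\<zero>\<^bsub>M\<^esub>, \<zero>\<^bsub>N\<^esub>),
       ring.add = (\<lambda>x y. (fst x \<oplus>\<^bsub>M\<^esub> fst y, snd x \<oplus>\<^bsub>N\<^esub> snd y)),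
       module.smult = (\<lambda>a x. (a \<odot>\<^bsub>M\<^esub> fst x, a \<odot>\<^bsub>N\<^esub> snd x)) \<rparr>"

lemma prod_module_simps [simp]:
  "carrier (prod_module M N) = carrier M \<times> carrier N"
  "\<zero>\<^bsub>prod_module M N\<^esub> = (\<zero>\<^bsub>M\<^esub>, \<zero>\<^bsub>N\<^esub>)"
  "x \<oplus>\<^bsub>prod_module M N\<^esub> y = (fst x \<oplus>\<^bsub>M\<^esub> fst y, snd x \<oplus>\<^bsub>N\<^esub> snd y)"
  "a \<odot>\<^bsub>prod_module M N\<^esub> x = (a \<odot>\<^bsub>M\<^esub> fst x, a \<odot>\<^bsub>N\<^esub> snd x)"
  by (simp_all add: prod_module_def)

lemma module_prod_module:
  assumes "module R M" "module R N"
  shows "module R (prod_module M N)"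
proof -
  interpret M: module R M by fact
  interpret N: module R N by fact
  show ?thesis
  proof (intro moduleI abelian_groupI)
    fix x assume "x \<in> carrier (prod_module M N)"
    then show "\<exists>y\<in>carrier (prod_module M N). y \<oplus>\<^bsub>prod_module M N\<^esub> x = \<zero>\<^bsub>prod_module M N\<^esub>"
      by (intro bexI[of _ "(\<ominus>\<^bsub>M\<^esub> fst x, \<ominus>\<^bsub>N\<^esub> snd x)"]) (auto simp: M.l_neg N.l_neg)
  qed (auto simp: M.R.is_cring M.smult_l_distr M.smult_r_distr M.smult_assoc1
      N.smult_l_distr N.smult_r_distr N.smult_assoc1 M.a_ac N.a_ac)
qed

lemma linear_map_fst: "linear_map R (prod_module M N) M fst"
  and linear_map_snd: "linear_map R (prod_module M N) N snd"
  by (auto intro!: linear_mapI)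

lemma linear_map_pair:
  assumes "linear_map R L M f" "linear_map R L N g"
  shows "linear_map R L (prod_module M N) (\<lambda>x. (f x, g x))"
  by (rule linear_mapI) (simp_all add: linear_mapD[OF assms(1)] linear_mapD[OF assms(2)])

section \<open>Vectors and matrices\<close>

definition vec_module :: "'a ring \<Rightarrow> 'i set \<Rightarrow> ('a, 'i \<Rightarrow> 'a) module" where
  "vec_module R J =
     \<lparr> carrier = {v. (\<forall>i\<in>J. v i \<in> carrier R) \<and> (\<forall>i. i \<notin> J \<longrightarrow> v i = \<zero>\<^bsub>R\<^esub>)},
       monoid.mult = (\<lambda>v w i. \<zero>\<^bsub>R\<^esub>),
       one = (\<lambda>i. \<zero>\<^bsub>R\<^esub>),
       ring.zero = (\<lambda>i. \<zero>\<^bsub>R\<^esub>),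
       ring.add = (\<lambda>v w i. v i \<oplus>\<^bsub>R\<^esub> w i),
       module.smult = (\<lambda>a v i. a \<otimes>\<^bsub>R\<^esub> v i) \<rparr>"

lemma vec_module_simps [simp]:
  "\<zero>\<^bsub>vec_module R J\<^esub> = (\<lambda>i. \<zero>\<^bsub>R\<^esub>)"
  "v \<oplus>\<^bsub>vec_module R J\<^esub> w = (\<lambda>i. v i \<oplus>\<^bsub>R\<^esub> w i)"
  "a \<odot>\<^bsub>vec_module R J\<^esub> v = (\<lambda>i. a \<otimes>\<^bsub>R\<^esub> v i)"
  by (simp_all add: vec_module_def)

lemma in_vec_module_iff:
  "v \<in> carrier (vec_module R J) \<longleftrightarrow> (\<forall>i\<in>J. v i \<in> carrier R) \<and> (\<forall>i. i \<notin> J \<longrightarrow> v i = \<zero>\<^bsub>R\<^esub>)"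
  by (simp add: vec_module_def)

lemma free_module_eq_vec_module: "free_module R k = vec_module R {..<k}"
  by (simp add: free_module_def vec_module_def not_less Ball_def)

lemma self_module_simps [simp]:
  "carrier (self_module R) = carrier R" "\<zero>\<^bsub>self_module R\<^esub> = \<zero>\<^bsub>R\<^esub>"
  "x \<oplus>\<^bsub>self_module R\<^esub> y = x \<oplus>\<^bsub>R\<^esub> y" "x \<odot>\<^bsub>self_module R\<^esub> y = x \<otimes>\<^bsub>R\<^esub> y"
  by (simp_all add: self_module_def)

text \<open>Linear maps are defined over ring records without extension fields.\<close>

locale plain_cring = cring R for R :: "'a ring" (structure)
begin

lemma module_self_module: "module R (self_module R)"
proof (intro moduleI abelian_groupI)
  fix x assume "x \<in> carrier (self_module R)"
  then show "\<exists>y\<in>carrier (self_module R). y \<oplus>\<^bsub>self_module R\<^esub> x = \<zero>\<^bsub>self_module R\<^esub>"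
    by (intro bexI[of _ "\<ominus> x"]) (simp_all add: l_neg)
qed (auto simp: is_cring l_distr r_distr m_assoc a_ac)

lemma vec_closed: "v \<in> carrier (vec_module R J) \<Longrightarrow> v i \<in> carrier R"
  by (cases "i \<in> J") (auto simp: in_vec_module_iff)

lemma module_vec_module: "module R (vec_module R J)"
proof (intro moduleI abelian_groupI)
  fix v assume v: "v \<in> carrier (vec_module R J)"
  then show "\<exists>w\<in>carrier (vec_module R J). w \<oplus>\<^bsub>vec_module R J\<^esub> v = \<zero>\<^bsub>vec_module R J\<^esub>"
    by (intro bexI[of _ "\<lambda>i. \<ominus> v i"]) (auto simp: vec_closed[OF v] l_neg in_vec_module_iff)
qed (auto simp: in_vec_module_iff is_cring l_distr r_distr m_assoc a_ac vec_closed)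

lemma linear_map_component:
  assumes "linear_map R M (vec_module R J) f"
  shows "linear_map R M (self_module R) (\<lambda>x. f x i)"
  by (rule linear_mapI)
    (simp_all add: linear_mapD(2,3)[OF assms] vec_closed[OF linear_map_closed[OF assms]])

definition unit_vec :: "'i \<Rightarrow> 'i \<Rightarrow> 'a" where
  "unit_vec j = (\<lambda>i. if i = j then \<one> else \<zero>)"

lemma unit_vec_closed: "j \<in> J \<Longrightarrow> unit_vec j \<in> carrier (vec_module R J)"
  by (auto simp: unit_vec_def in_vec_module_iff)

definition dot :: "'i set \<Rightarrow> ('i \<Rightarrow> 'a) \<Rightarrow> ('i \<Rightarrow> 'a) \<Rightarrow> 'a" where
  "dot J a x = (\<Oplus>j\<in>J. a j \<otimes> x j)"

lemma dot_closed [simp]: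
  "\<lbrakk>a \<in> J \<rightarrow> carrier R; x \<in> J \<rightarrow> carrier R\<rbrakk> \<Longrightarrow> dot J a x \<in> carrier R"
  unfolding dot_def by (auto intro!: finsum_closed)

lemma dot_cong:
  assumes "\<And>j. j \<in> J \<Longrightarrow> a j \<otimes> x j = b j \<otimes> y j" "b \<in> J \<rightarrow> carrier R" "y \<in> J \<rightarrow> carrier R"
  shows "dot J a x = dot J b y"
  unfolding dot_def using assms by (intro finsum_cong') auto

lemma dot_zero:
  assumes "\<And>j. j \<in> J \<Longrightarrow> a j \<otimes> x j = \<zero>"
  shows "dot J a x = \<zero>"
proof -
  have "dot J a x = (\<Oplus>j\<in>J. \<zero>)"
    unfolding dot_def using assms by (intro finsum_cong') auto
  then show ?thesis by simp
qed

lemma dot_commute: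
  assumes "a \<in> J \<rightarrow> carrier R" "x \<in> J \<rightarrow> carrier R"
  shows "dot J a x = dot J x a"
  using assms by (intro dot_cong) (auto simp: m_comm Pi_iff)

lemma dot_add:
  assumes "\<And>j. j \<in> J \<Longrightarrow> c j \<otimes> z j = a j \<otimes> x j \<oplus> b j \<otimes> y j"
    and "a \<in> J \<rightarrow> carrier R" "x \<in> J \<rightarrow> carrier R" "b \<in> J \<rightarrow> carrier R" "y \<in> J \<rightarrow> carrier R"
  shows "dot J c z = dot J a x \<oplus> dot J b y"
proof -
  have "dot J c z = (\<Oplus>j\<in>J. a j \<otimes> x j \<oplus> b j \<otimes> y j)"
    unfolding dot_def using assms by (intro finsum_cong') (auto simp: Pi_iff)
  also have "\<dots> = dot J a x \<oplus> dot J b y"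
    unfolding dot_def using assms(2-5) by (intro finsum_addf) auto
  finally show ?thesis .
qed

lemma dot_smult:
  assumes "\<And>j. j \<in> J \<Longrightarrow> c j \<otimes> z j = r \<otimes> (a j \<otimes> x j)"
    and "finite J" "r \<in> carrier R" "a \<in> J \<rightarrow> carrier R" "x \<in> J \<rightarrow> carrier R"
  shows "dot J c z = r \<otimes> dot J a x"
proof -
  have "dot J c z = (\<Oplus>j\<in>J. r \<otimes> (a j \<otimes> x j))"
    unfolding dot_def using assms by (intro finsum_cong') (auto simp: Pi_iff)
  also have "\<dots> = r \<otimes> dot J a x"
    unfolding dot_def using assms(2-5) by (intro finsum_rdistr[symmetric]) auto
  finally show ?thesis .
qed

lemma linear_map_dot:
  assumes "finite J" "a \<in> J \<rightarrow> carrier R"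
  shows "linear_map R (vec_module R J) (self_module R) (dot J a)"
proof (rule linear_mapI)
  fix x assume x: "x \<in> carrier (vec_module R J)"
  note closed = assms(2)[THEN funcset_mem] vec_closed[OF x]
  show "dot J a x \<in> carrier (self_module R)"
    using closed by simp
  show "dot J a (r \<odot>\<^bsub>vec_module R J\<^esub> x) = r \<odot>\<^bsub>self_module R\<^esub> dot J a x" if "r \<in> carrier R" for r
    using that closed assms(1) by (simp, intro dot_smult) (auto simp: m_lcomm)
  show "dot J a (x \<oplus>\<^bsub>vec_module R J\<^esub> y) = dot J a x \<oplus>\<^bsub>self_module R\<^esub> dot J a y"
    if "y \<in> carrier (vec_module R J)" for y
    using closed vec_closed[OF that] by (simp, intro dot_add) (auto simp: r_distr)
qed

lemma dot_remove:
  assumes "finite J" "q \<in> J" "a \<in> J \<rightarrow> carrier R" "x \<in> J \<rightarrow> carrier R"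
  shows "dot J a x = a q \<otimes> x q \<oplus> dot (J - {q}) a x"
proof -
  have "(\<Oplus>j\<in>insert q (J - {q}). a j \<otimes> x j) = a q \<otimes> x q \<oplus> (\<Oplus>j\<in>J - {q}. a j \<otimes> x j)"
    using assms by (intro finsum_insert) auto
  then show ?thesis using assms(2) by (simp add: dot_def insert_absorb)
qed

lemma dot_unit_vec:
  assumes "finite J" "j \<in> J" "a \<in> J \<rightarrow> carrier R"
  shows "dot J a (unit_vec j) = a j"
proof -
  have "dot (J - {j}) a (unit_vec j) = \<zero>"
    using assms(3) by (intro dot_zero) (auto simp: unit_vec_def Pi_iff)
  moreover have "a j \<in> carrier R" using assms(2,3) by auto
  ultimately show ?thesis
    using assms by (subst dot_remove[OF assms(1,2)]) (auto simp: unit_vec_def)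
qed

lemma linear_functional_split_coordinate:
  assumes g: "linear_map R (vec_module R J) (self_module R) g"
    and j: "j \<in> J" and x: "x \<in> carrier (vec_module R J)"
  shows "g x = x j \<otimes> g (unit_vec j) \<oplus> g (x(j := \<zero>))"
proof -
  have e: "unit_vec j \<in> carrier (vec_module R J)" using j by (rule unit_vec_closed)
  have rest: "x(j := \<zero>) \<in> carrier (vec_module R J)" using x by (auto simp: in_vec_module_iff)
  have "x = (x j \<odot>\<^bsub>vec_module R J\<^esub> unit_vec j) \<oplus>\<^bsub>vec_module R J\<^esub> x(j := \<zero>)"
    using vec_closed[OF x] by (auto simp: unit_vec_def)
  then have "g x = g (x j \<odot>\<^bsub>vec_module R J\<^esub> unit_vec j) \<oplus> g (x(j := \<zero>))"
    using linear_map_add[OF g module.smult_closed[OF module_vec_module vec_closed[OF x] e] rest]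
    by (metis self_module_simps(3))
  also have "g (x j \<odot>\<^bsub>vec_module R J\<^esub> unit_vec j) = x j \<otimes> g (unit_vec j)"
    using linear_map_smult[OF g vec_closed[OF x] e] by simp
  finally show ?thesis .
qed

lemma linear_functional_eq_dot:
  assumes g: "linear_map R (vec_module R J) (self_module R) g"
    and "finite J" "x \<in> carrier (vec_module R J)"
  shows "g x = dot J (\<lambda>j. g (unit_vec j)) x"
proof -
  have g_closed: "g (unit_vec j) \<in> carrier R" if "j \<in> J" for j
    using linear_map_closed[OF g unit_vec_closed[OF that]] by simp
  have "g y = dot K (\<lambda>j. g (unit_vec j)) y"
    if "finite K" "K \<subseteq> J" "y \<in> carrier (vec_module R K)" for K y
    using that
  proof (induction arbitrary: y rule: finite_induct)
    case empty
    then have "y = \<zero>\<^bsub>vec_module R J\<^esub>" by (auto simp: in_vec_module_iff)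
    then show ?case
      using linear_map_zero[OF module_vec_module module_self_module g] by (simp add: dot_def)
  next
    case (insert j K)
    note y_closed = vec_closed[OF insert.prems(2)]
    have "y \<in> carrier (vec_module R J)" and rest: "y(j := \<zero>) \<in> carrier (vec_module R K)"
      using insert.prems by (auto simp: in_vec_module_iff)
    then have "g y = y j \<otimes> g (unit_vec j) \<oplus> g (y(j := \<zero>))"
      using insert.prems(1) by (intro linear_functional_split_coordinate[OF g]) auto
    also have "g (y(j := \<zero>)) = dot K (\<lambda>j. g (unit_vec j)) (y(j := \<zero>))"
      using insert.IH[OF _ rest] insert.prems(1) by blast
    also have "\<dots> = dot K (\<lambda>j. g (unit_vec j)) y"
      using insert.hyps(2) insert.prems(1) y_closed g_closed by (intro dot_cong) auto
    also have "y j \<otimes> g (unit_vec j) \<oplus> \<dots> = dot (insert j K) (\<lambda>j. g (unit_vec j)) y"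
      using insert.hyps insert.prems(1) y_closed g_closed
      by (subst dot_remove[of "insert j K" j]) (auto simp: m_comm)
    finally show ?case .
  qed
  then show ?thesis using assms(2,3) by blast
qed

lemma linear_functional_representable:
  assumes g: "linear_map R (vec_module R J) (self_module R) g" and "finite J"
  shows "\<exists>c\<in>carrier (vec_module R J). \<forall>x\<in>carrier (vec_module R J). g x = dot J c x"
proof
  let ?c = "\<lambda>j. if j \<in> J then g (unit_vec j) else \<zero>"
  have coord: "g (unit_vec j) \<in> carrier R" if "j \<in> J" for j
    using linear_map_closed[OF g unit_vec_closed[OF that]] by simp
  then show "?c \<in> carrier (vec_module R J)" by (simp add: in_vec_module_iff)
  show "\<forall>x\<in>carrier (vec_module R J). g x = dot J ?c x"
  proof
    fix x assume x: "x \<in> carrier (vec_module R J)"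
    have "g x = dot J (\<lambda>j. g (unit_vec j)) x" by (rule linear_functional_eq_dot[OF assms x])
    also have "\<dots> = dot J ?c x" using coord vec_closed[OF x] by (intro dot_cong) auto
    finally show "g x = dot J ?c x" .
  qed
qed

lemma vec_eqI_dot:
  assumes "finite J" and x: "x \<in> carrier (vec_module R J)" and y: "y \<in> carrier (vec_module R J)"
    and eq: "\<And>w. w \<in> carrier (vec_module R J) \<Longrightarrow> dot J x w = dot J y w"
  shows "x = y"
proof
  fix j
  show "x j = y j"
  proof (cases "j \<in> J")
    case True
    then have "dot J x (unit_vec j) = dot J y (unit_vec j)" by (intro eq unit_vec_closed)
    then show ?thesis
      using True vec_closed[OF x] vec_closed[OF y] by (simp add: dot_unit_vec[OF assms(1)])
  next
    case False
    then show ?thesis using x y by (simp add: in_vec_module_iff)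
  qed
qed

definition mat_map :: "'i set \<Rightarrow> 'j set \<Rightarrow> ('i \<Rightarrow> 'j \<Rightarrow> 'a) \<Rightarrow> ('j \<Rightarrow> 'a) \<Rightarrow> 'i \<Rightarrow> 'a" where
  "mat_map I J A x = (\<lambda>i. if i \<in> I then dot J (A i) x else \<zero>)"

lemma linear_map_mat_map:
  assumes "finite J" "\<And>i j. \<lbrakk>i \<in> I; j \<in> J\<rbrakk> \<Longrightarrow> A i j \<in> carrier R"
  shows "linear_map R (vec_module R J) (vec_module R I) (mat_map I J A)"
proof (rule linear_mapI)
  have "linear_map R (vec_module R J) (self_module R) (dot J (A i))" if "i \<in> I" for i
    using assms that by (intro linear_map_dot) auto
  note dot_lin = linear_mapD[OF this]
  fix x assume x: "x \<in> carrier (vec_module R J)"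
  show "mat_map I J A x \<in> carrier (vec_module R I)"
    using dot_lin(1)[OF _ x] by (auto simp: in_vec_module_iff mat_map_def)
  show "mat_map I J A (r \<odot>\<^bsub>vec_module R J\<^esub> x) = r \<odot>\<^bsub>vec_module R I\<^esub> mat_map I J A x"
    if "r \<in> carrier R" for r
    using dot_lin(3)[OF _ that x] that by (auto simp: mat_map_def)
  show "mat_map I J A (x \<oplus>\<^bsub>vec_module R J\<^esub> y) = mat_map I J A x \<oplus>\<^bsub>vec_module R I\<^esub> mat_map I J A y"
    if "y \<in> carrier (vec_module R J)" for y
    using dot_lin(2)[OF _ x that] by (auto simp: mat_map_def)
qed

lemma linear_map_has_matrix:
  assumes d: "linear_map R (vec_module R J) (vec_module R I) d" and "finite J"
  shows "\<exists>A. (\<forall>i\<in>I. \<forall>j\<in>J. A i j \<in> carrier R) \<and> (\<forall>x\<in>carrier (vec_module R J). d x = mat_map I J A x)"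
proof (intro exI conjI ballI)
  let ?A = "\<lambda>i j. d (unit_vec j) i"
  show "?A i j \<in> carrier R" if "j \<in> J" for i j
    using vec_closed[OF linear_map_closed[OF d unit_vec_closed[OF that]]] .
  fix x assume x: "x \<in> carrier (vec_module R J)"
  show "d x = mat_map I J ?A x"
  proof
    fix i
    show "d x i = mat_map I J ?A x i"
      using linear_functional_eq_dot[OF linear_map_component[OF d] assms(2) x]
        linear_map_closed[OF d x]
      by (simp add: mat_map_def in_vec_module_iff)
  qed
qed

lemma lin_kernel_mat_map:
  "x \<in> lin_kernel (vec_module R J) (vec_module R I) (mat_map I J A) \<longleftrightarrow>
    x \<in> carrier (vec_module R J) \<and> (\<forall>i\<in>I. dot J (A i) x = \<zero>)"
  by (auto simp: lin_kernel_def mat_map_def fun_eq_iff)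

lemma dot_mat_map_transpose:
  assumes "finite I" "finite J" and A: "\<And>i j. \<lbrakk>i \<in> I; j \<in> J\<rbrakk> \<Longrightarrow> A i j \<in> carrier R"
    and x: "x \<in> carrier (vec_module R I)" and y: "y \<in> carrier (vec_module R J)"
  shows "dot I x (mat_map I J A y) = dot J (mat_map J I (\<lambda>j i. A i j) x) y"
proof -
  have lin: "linear_map R (vec_module R J) (self_module R) (\<lambda>y. dot I x (mat_map I J A y))"
    using vec_closed[OF x] assms
    by (intro linear_map_compose[OF linear_map_mat_map linear_map_dot]) auto
  have "dot I x (mat_map I J A (unit_vec j)) = mat_map J I (\<lambda>j i. A i j) x j" if "j \<in> J" for j
  proof -
    have "dot I x (mat_map I J A (unit_vec j)) = dot I x (\<lambda>i. A i j)"
      using dot_unit_vec[OF assms(2) that] A vec_closed[OF x] A that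
      by (intro dot_cong) (auto simp: mat_map_def)
    also have "\<dots> = dot I (\<lambda>i. A i j) x"
      using vec_closed[OF x] A that by (intro dot_commute) auto
    finally show ?thesis using that by (simp add: mat_map_def)
  qed
  moreover have "mat_map J I (\<lambda>j i. A i j) x \<in> J \<rightarrow> carrier R"
    using A vec_closed[OF x] by (auto simp: mat_map_def intro!: dot_closed)
  ultimately have "dot J (\<lambda>j. dot I x (mat_map I J A (unit_vec j))) y =
      dot J (mat_map J I (\<lambda>j i. A i j) x) y"
    using vec_closed[OF y] by (intro dot_cong) auto
  then show ?thesis
    using linear_functional_eq_dot[OF lin assms(2) y] by simp
qed

lemma mat_map_transpose_compose_zero:
  assumes "finite I" "finite J" "finite K"
    and A: "\<And>i j. \<lbrakk>i \<in> I; j \<in> J\<rbrakk> \<Longrightarrow> A i j \<in> carrier R"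
    and B: "\<And>j k. \<lbrakk>j \<in> J; k \<in> K\<rbrakk> \<Longrightarrow> B j k \<in> carrier R"
    and zero: "\<And>y. y \<in> carrier (vec_module R K) \<Longrightarrow> mat_map I J A (mat_map J K B y) = (\<lambda>i. \<zero>)"
    and x: "x \<in> carrier (vec_module R I)"
  shows "mat_map K J (\<lambda>k j. B j k) (mat_map J I (\<lambda>j i. A i j) x) = (\<lambda>k. \<zero>)"
proof (rule vec_eqI_dot[OF assms(3)])
  let ?At = "mat_map J I (\<lambda>j i. A i j)" and ?Bt = "mat_map K J (\<lambda>k j. B j k)"
  have "linear_map R (vec_module R K) (vec_module R J) (mat_map J K B)"
    "linear_map R (vec_module R I) (vec_module R J) ?At"
    "linear_map R (vec_module R J) (vec_module R K) ?Bt"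
    using assms(1-3) A B by (auto intro!: linear_map_mat_map)
  note closed = this[THEN linear_map_closed]
  show "?Bt (?At x) \<in> carrier (vec_module R K)" by (intro closed x)
  show "(\<lambda>k. \<zero>) \<in> carrier (vec_module R K)" by (simp add: in_vec_module_iff)
  fix y assume y: "y \<in> carrier (vec_module R K)"
  have "dot K (?Bt (?At x)) y = dot J (?At x) (mat_map J K B y)"
    using B by (intro dot_mat_map_transpose[symmetric] assms closed x y) auto
  also have "\<dots> = dot I x (mat_map I J A (mat_map J K B y))"
    using A by (intro dot_mat_map_transpose[symmetric] assms closed x y) auto
  also have "\<dots> = dot K (\<lambda>k. \<zero>) y"
    using vec_closed[OF x] vec_closed[OF y] by (simp add: zero[OF y] dot_zero)
  finally show "dot K (?Bt (?At x)) y = dot K (\<lambda>k. \<zero>) y" .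
qed

end

section \<open>Local finite generation\<close>

text \<open>The elements \<open>s\<close> such that \<open>M\<close> becomes finitely generated after inverting \<open>s\<close>, with one
  denominator for all of \<open>M\<close>. By this uniformity \<open>M\<close> is finitely generated iff for each maximal
  ideal some \<open>s\<close> lies outside it; finite generation of all localizations would not suffice.\<close>

definition fg_ideal :: "'a ring \<Rightarrow> ('a, 'm) module \<Rightarrow> 'a set" where
  "fg_ideal R M = {s \<in> carrier R. \<exists>k f. linear_map R (free_module R k) M f \<and>
     (\<forall>x\<in>carrier M. s \<odot>\<^bsub>M\<^esub> x \<in> f ` carrier (free_module R k))}"

lemma fg_ideal_closed: "s \<in> fg_ideal R M \<Longrightarrow> s \<in> carrier R"
  by (simp add: fg_ideal_def)

lemma fg_idealI:
  assumes "s \<in> carrier R" "linear_map R (free_module R k) M f"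
    and "\<And>x. x \<in> carrier M \<Longrightarrow> \<exists>u\<in>carrier (free_module R k). s \<odot>\<^bsub>M\<^esub> x = f u"
  shows "s \<in> fg_ideal R M"
  using assms unfolding fg_ideal_def by blast

lemma fg_idealE:
  assumes "s \<in> fg_ideal R M"
  obtains k f where "linear_map R (free_module R k) M f"
    and "\<And>x. x \<in> carrier M \<Longrightarrow> \<exists>u\<in>carrier (free_module R k). s \<odot>\<^bsub>M\<^esub> x = f u"
  using assms unfolding fg_ideal_def by blast

lemma (in ring) exists_maximalideal:
  assumes "ideal I R" "\<one> \<notin> I"
  shows "\<exists>M. maximalideal M R \<and> I \<subseteq> M"
proof -
  define A where "A = {J. ideal J R \<and> I \<subseteq> J \<and> \<one> \<notin> J}"
  have "\<exists>M\<in>A. \<forall>J\<in>A. M \<subseteq> J \<longrightarrow> J = M"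
  proof (rule subset_Zorn_nonempty)
    show "A \<noteq> {}" using assms unfolding A_def by blast
    fix C assume C: "C \<noteq> {}" "subset.chain A C"
    then have "subset.chain {J. ideal J R} C"
      by (auto simp: subset_chain_def A_def)
    then have "ideal (\<Union>C) R"
      using chain_Union_is_ideal[of C] C(1) by simp
    then show "\<Union>C \<in> A"
      using C by (auto simp: subset_chain_def A_def)
  qed
  then obtain M where "M \<in> A" and maximal: "\<And>J. \<lbrakk>J \<in> A; M \<subseteq> J\<rbrakk> \<Longrightarrow> J = M"
    by blast
  then have M: "ideal M R" "I \<subseteq> M" "\<one> \<notin> M" by (simp_all add: A_def)
  have "maximalideal M R"
  proof (rule maximalidealI[OF M(1)])
    show "carrier R \<noteq> M" using M(3) one_closed by blast
    fix J assume J: "ideal J R" "M \<subseteq> J" "J \<subseteq> carrier R"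
    then show "J = M \<or> J = carrier R"
      using maximal[of J] M(2) ideal.one_imp_carrier[OF J(1)] unfolding A_def by blast
  qed
  with M(2) show ?thesis by blast
qed

lemma (in primeideal) one_notin: "\<one> \<notin> I"
  using I_notcarr one_imp_carrier by blast

context plain_cring
begin

lemma one_in_fg_ideal_iff:
  assumes "module R M"
  shows "\<one> \<in> fg_ideal R M \<longleftrightarrow>
    (\<exists>k f. linear_map R (free_module R k) M f \<and> f ` carrier (free_module R k) = carrier M)"
proof -
  interpret M: module R M by fact
  have "(\<forall>x\<in>carrier M. \<one> \<odot>\<^bsub>M\<^esub> x \<in> f ` C) \<longleftrightarrow> f ` C = carrier M"
    if "f ` C \<subseteq> carrier M" for f :: "(nat \<Rightarrow> 'a) \<Rightarrow> 'b" and C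
    using that by auto
  then show ?thesis
    unfolding fg_ideal_def by (simp add: linear_map_def Pi_iff image_subset_iff cong: conj_cong)
qed

lemma one_in_fg_ideal_kernel_iff:
  assumes "module R M" "module R N" "linear_map R M N f"
  shows "\<one> \<in> fg_ideal R (kernel_module M N f) \<longleftrightarrow>
    (\<exists>k h. linear_map R (free_module R k) M h \<and> h ` carrier (free_module R k) = lin_kernel M N f)"
proof -
  have "linear_map R L (kernel_module M N f) h \<longleftrightarrow> linear_map R L M h"
    if "h ` carrier L = lin_kernel M N f" for L :: "('a, nat \<Rightarrow> 'a) module" and h
    using that by (fastforce simp: linear_map_def lin_kernel_def)
  then show ?thesis
    unfolding one_in_fg_ideal_iff[OF module_kernel_module[OF assms]] kernel_module_simps by blast
qed

lemma fg_ideal_linear_image: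
  assumes M: "module R M" and s: "s \<in> fg_ideal R L" and f: "linear_map R L M f"
    and r: "r \<in> carrier R" and image: "\<And>x. x \<in> carrier M \<Longrightarrow> r \<odot>\<^bsub>M\<^esub> x \<in> f ` carrier L"
  shows "s \<otimes> r \<in> fg_ideal R M"
proof -
  interpret M: module R M by fact
  obtain k h where h: "linear_map R (free_module R k) L h"
    and cover: "\<And>y. y \<in> carrier L \<Longrightarrow> \<exists>u\<in>carrier (free_module R k). s \<odot>\<^bsub>L\<^esub> y = h u"
    using fg_idealE[OF s] by blast
  note sR = fg_ideal_closed[OF s]
  show ?thesis
  proof (rule fg_idealI[OF m_closed[OF sR r] linear_map_compose[OF h f]])
    fix x assume x: "x \<in> carrier M"
    obtain y where y: "y \<in> carrier L" "r \<odot>\<^bsub>M\<^esub> x = f y" using image[OF x] by blast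
    obtain u where u: "u \<in> carrier (free_module R k)" "s \<odot>\<^bsub>L\<^esub> y = h u" using cover[OF y(1)] by blast
    have "s \<otimes> r \<odot>\<^bsub>M\<^esub> x = f (h u)"
      using sR r x y u linear_map_smult[OF f sR y(1)] by (simp add: M.smult_assoc1)
    then show "\<exists>u\<in>carrier (free_module R k). s \<otimes> r \<odot>\<^bsub>M\<^esub> x = f (h u)" using u(1) by blast
  qed
qed

lemma one_in_fg_ideal_vec_module:
  assumes "finite J"
  shows "\<one> \<in> fg_ideal R (vec_module R J)"
proof -
  obtain e where e: "bij_betw e J {..<card J}"
    using ex_bij_betw_finite_nat[OF assms] by (auto simp: atLeast0LessThan)
  define f where "f x = (\<lambda>j. if j \<in> J then x (e j) else \<zero>)" for x :: "nat \<Rightarrow> 'a"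
  have f: "linear_map R (free_module R (card J)) (vec_module R J) f"
    using bij_betwE[OF e]
    by (intro linear_mapI) (auto simp: free_module_eq_vec_module in_vec_module_iff f_def)
  have "x \<in> f ` carrier (free_module R (card J))" if x: "x \<in> carrier (vec_module R J)" for x
  proof
    let ?u = "\<lambda>k. if k < card J then x (inv_into J e k) else \<zero>"
    show "x = f ?u"
      using x bij_betwE[OF e] bij_betw_inv_into_left[OF e] by (auto simp: f_def in_vec_module_iff)
    show "?u \<in> carrier (free_module R (card J))"
      using vec_closed[OF x] by (simp add: free_module_eq_vec_module in_vec_module_iff)
  qed
  then have "f ` carrier (free_module R (card J)) = carrier (vec_module R J)"
    using linear_map_closed[OF f] by blast
  then show ?thesis
    unfolding one_in_fg_ideal_iff[OF module_vec_module] using f by blast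
qed

lemma one_in_fg_ideal_prod_vec_module:
  assumes "finite I" "finite J"
  shows "\<one> \<in> fg_ideal R (prod_module (vec_module R I) (vec_module R J))"
proof -
  let ?P = "prod_module (vec_module R I) (vec_module R J)"
  let ?f = "\<lambda>x. (\<lambda>i. x (Inl i), \<lambda>j. x (Inr j))"
  have f: "linear_map R (vec_module R (I <+> J)) ?P ?f"
    by (rule linear_mapI) (auto simp: in_vec_module_iff)
  have "z \<in> ?f ` carrier (vec_module R (I <+> J))" if z: "z \<in> carrier ?P" for z
  proof
    show "z = ?f (case_sum (fst z) (snd z))" by simp
    show "case_sum (fst z) (snd z) \<in> carrier (vec_module R (I <+> J))"
      using z by (auto simp: in_vec_module_iff split: sum.split)
  qed
  moreover have P: "module R ?P"
    by (intro module_prod_module module_vec_module)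
  ultimately have "\<one> \<otimes> \<one> \<in> fg_ideal R ?P"
    using assms module.smult_one[OF P]
    by (intro fg_ideal_linear_image[OF P one_in_fg_ideal_vec_module f]) auto
  then show ?thesis by simp
qed

lemma fg_idealI_two_maps:
  assumes M: "module R M" and f: "linear_map R (free_module R k) M f"
    and g: "linear_map R (free_module R l) M g" and s: "s \<in> carrier R"
    and cover: "\<And>x. x \<in> carrier M \<Longrightarrow>
      \<exists>u\<in>carrier (free_module R k). \<exists>v\<in>carrier (free_module R l). s \<odot>\<^bsub>M\<^esub> x = f u \<oplus>\<^bsub>M\<^esub> g v"
  shows "s \<in> fg_ideal R M"
proof -
  let ?P = "prod_module (free_module R k) (free_module R l)"
  have "linear_map R ?P M (\<lambda>z. f (fst z) \<oplus>\<^bsub>M\<^esub> g (snd z))"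
    by (intro linear_map_sum[OF M] linear_map_compose[OF linear_map_fst f]
        linear_map_compose[OF linear_map_snd g])
  moreover have "s \<odot>\<^bsub>M\<^esub> x \<in> (\<lambda>z. f (fst z) \<oplus>\<^bsub>M\<^esub> g (snd z)) ` carrier ?P" if "x \<in> carrier M" for x
    using cover[OF that] by force
  ultimately have "\<one> \<otimes> s \<in> fg_ideal R M"
    using s unfolding free_module_eq_vec_module
    by (intro fg_ideal_linear_image[OF M one_in_fg_ideal_prod_vec_module]) auto
  then show ?thesis using s by simp
qed

lemma fg_ideal_prod:
  assumes M: "module R M" and N: "module R N" and s: "s \<in> fg_ideal R M" and t: "t \<in> fg_ideal R N"
  shows "s \<otimes> t \<in> fg_ideal R (prod_module M N)"
proof -
  interpret M: module R M by fact
  interpret N: module R N by fact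
  obtain k f where f: "linear_map R (free_module R k) M f"
    and f_cover: "\<And>x. x \<in> carrier M \<Longrightarrow> \<exists>u\<in>carrier (free_module R k). s \<odot>\<^bsub>M\<^esub> x = f u"
    using fg_idealE[OF s] by blast
  obtain l g where g: "linear_map R (free_module R l) N g"
    and g_cover: "\<And>y. y \<in> carrier N \<Longrightarrow> \<exists>v\<in>carrier (free_module R l). t \<odot>\<^bsub>N\<^esub> y = g v"
    using fg_idealE[OF t] by blast
  note st = fg_ideal_closed[OF s] fg_ideal_closed[OF t]
  have f': "linear_map R (free_module R k) (prod_module M N) (\<lambda>u. (f u, \<zero>\<^bsub>N\<^esub>))"
    by (rule linear_mapI) (simp_all add: linear_mapD[OF f])
  have g': "linear_map R (free_module R l) (prod_module M N) (\<lambda>v. (\<zero>\<^bsub>M\<^esub>, g v))"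
    by (rule linear_mapI) (simp_all add: linear_mapD[OF g])
  show ?thesis
  proof (rule fg_idealI_two_maps[OF module_prod_module[OF M N] f' g' m_closed[OF st]])
    fix z assume "z \<in> carrier (prod_module M N)"
    then obtain x y where z: "z = (x, y)" and x: "x \<in> carrier M" and y: "y \<in> carrier N"
      by auto
    obtain u where u: "u \<in> carrier (free_module R k)" "s \<odot>\<^bsub>M\<^esub> (t \<odot>\<^bsub>M\<^esub> x) = f u"
      using f_cover x st by blast
    obtain v where v: "v \<in> carrier (free_module R l)" "t \<odot>\<^bsub>N\<^esub> (s \<odot>\<^bsub>N\<^esub> y) = g v"
      using g_cover y st by blast
    have "s \<otimes> t \<odot>\<^bsub>M\<^esub> x = f u"
      using st x u(2) by (simp add: M.smult_assoc1)
    moreover have "s \<otimes> t \<odot>\<^bsub>N\<^esub> y = g v"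
      using st y v(2) by (simp add: m_comm[of s t] N.smult_assoc1)
    ultimately show "\<exists>u\<in>carrier (free_module R k). \<exists>v\<in>carrier (free_module R l).
        s \<otimes> t \<odot>\<^bsub>prod_module M N\<^esub> z = (f u, \<zero>\<^bsub>N\<^esub>) \<oplus>\<^bsub>prod_module M N\<^esub> (\<zero>\<^bsub>M\<^esub>, g v)"
      using u(1) v(1) linear_map_closed[OF f u(1)] linear_map_closed[OF g v(1)]
      by (intro bexI[of _ u] bexI[of _ v]) (simp_all add: z)
  qed
qed

lemma fg_ideal_add:
  assumes M: "module R M" and s: "s \<in> fg_ideal R M" and t: "t \<in> fg_ideal R M"
  shows "s \<oplus> t \<in> fg_ideal R M"
proof -
  interpret M: module R M by fact
  obtain k f where f: "linear_map R (free_module R k) M f"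
    and f_cover: "\<And>x. x \<in> carrier M \<Longrightarrow> \<exists>u\<in>carrier (free_module R k). s \<odot>\<^bsub>M\<^esub> x = f u"
    using fg_idealE[OF s] by blast
  obtain l g where g: "linear_map R (free_module R l) M g"
    and g_cover: "\<And>x. x \<in> carrier M \<Longrightarrow> \<exists>v\<in>carrier (free_module R l). t \<odot>\<^bsub>M\<^esub> x = g v"
    using fg_idealE[OF t] by blast
  note st = fg_ideal_closed[OF s] fg_ideal_closed[OF t]
  show ?thesis
  proof (rule fg_idealI_two_maps[OF M f g a_closed[OF st]])
    fix x assume x: "x \<in> carrier M"
    show "\<exists>u\<in>carrier (free_module R k). \<exists>v\<in>carrier (free_module R l).
        (s \<oplus> t) \<odot>\<^bsub>M\<^esub> x = f u \<oplus>\<^bsub>M\<^esub> g v"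
      using f_cover[OF x] g_cover[OF x] x st by (metis M.smult_l_distr)
  qed
qed

lemma fg_ideal_mult:
  assumes M: "module R M" and s: "s \<in> fg_ideal R M" and r: "r \<in> carrier R"
  shows "s \<otimes> r \<in> fg_ideal R M"
proof (rule fg_ideal_linear_image[OF M s _ r])
  show "linear_map R M M (\<lambda>x. x)" by (rule linear_mapI) simp_all
  show "r \<odot>\<^bsub>M\<^esub> x \<in> (\<lambda>x. x) ` carrier M" if "x \<in> carrier M" for x
    using module.smult_closed[OF M r that] by simp
qed

lemma ideal_fg_ideal:
  assumes M: "module R M"
  shows "ideal (fg_ideal R M) R"
proof (rule idealI[OF ring_axioms])
  interpret M: module R M by fact
  show "s \<otimes> r \<in> fg_ideal R M" "r \<otimes> s \<in> fg_ideal R M"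
    if "s \<in> fg_ideal R M" "r \<in> carrier R" for s r
    using fg_ideal_mult[OF M that] m_comm[OF fg_ideal_closed[OF that(1)] that(2)] by metis+
  show "subgroup (fg_ideal R M) (add_monoid R)"
  proof (rule add.subgroupI)
    show "fg_ideal R M \<subseteq> carrier R" by (auto dest: fg_ideal_closed)
    have "linear_map R (free_module R 0) M (\<lambda>_. \<zero>\<^bsub>M\<^esub>)"
      by (rule linear_mapI) simp_all
    then have "\<zero> \<in> fg_ideal R M"
      by (rule fg_idealI[OF zero_closed]) (auto simp: free_module_def)
    then show "fg_ideal R M \<noteq> {}" by blast
    show "\<ominus> s \<in> fg_ideal R M" if "s \<in> fg_ideal R M" for s
      using fg_ideal_mult[OF M that, of "\<ominus> \<one>"] fg_ideal_closed[OF that] by (simp add: r_minus)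
    show "s \<oplus> t \<in> fg_ideal R M" if "s \<in> fg_ideal R M" "t \<in> fg_ideal R M" for s t
      using that by (rule fg_ideal_add[OF M])
  qed
qed

definition fg_at :: "'a set \<Rightarrow> ('a, 'm) module \<Rightarrow> bool" where
  "fg_at P M \<longleftrightarrow> \<not> fg_ideal R M \<subseteq> P"

lemma one_in_fg_idealI_maximal:
  assumes "module R M" "\<And>P. maximalideal P R \<Longrightarrow> fg_at P M"
  shows "\<one> \<in> fg_ideal R M"
  using exists_maximalideal[OF ideal_fg_ideal[OF assms(1)]] assms(2) unfolding fg_at_def by blast

lemma one_in_fg_ideal_imp_fg_at:
  assumes "primeideal P R" "\<one> \<in> fg_ideal R M"
  shows "fg_at P M"
  using primeideal.one_notin[OF assms(1)] assms(2) unfolding fg_at_def by blast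

lemma fg_at_linear_image:
  assumes P: "primeideal P R" and M: "module R M" and f: "linear_map R L M f"
    and r: "r \<in> carrier R - P" and image: "\<And>x. x \<in> carrier M \<Longrightarrow> r \<odot>\<^bsub>M\<^esub> x \<in> f ` carrier L"
    and fg: "fg_at P L"
  shows "fg_at P M"
proof -
  obtain s where s: "s \<in> fg_ideal R L" "s \<notin> P" using fg unfolding fg_at_def by blast
  have "s \<otimes> r \<in> fg_ideal R M"
    using r by (intro fg_ideal_linear_image[OF M s(1) f _ image]) auto
  moreover have "s \<otimes> r \<notin> P"
    using primeideal.I_prime[OF P, of s r] s r fg_ideal_closed[OF s(1)] by blast
  ultimately show ?thesis unfolding fg_at_def by blast
qed

lemma fg_at_prod_iff:
  assumes P: "primeideal P R" and M: "module R M" and N: "module R N"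
  shows "fg_at P (prod_module M N) \<longleftrightarrow> fg_at P M \<and> fg_at P N"
proof (intro iffI conjI)
  interpret M: module R M by fact
  interpret N: module R N by fact
  assume fg: "fg_at P (prod_module M N)"
  have one: "\<one> \<in> carrier R - P" using primeideal.one_notin[OF P] by simp
  show "fg_at P M"
    by (rule fg_at_linear_image[OF P M linear_map_fst one _ fg]) force
  show "fg_at P N"
    by (rule fg_at_linear_image[OF P N linear_map_snd one _ fg]) force
next
  assume "fg_at P M \<and> fg_at P N"
  then obtain s t where s: "s \<in> fg_ideal R M" "s \<notin> P" and t: "t \<in> fg_ideal R N" "t \<notin> P"
    unfolding fg_at_def by blast
  then have "s \<otimes> t \<notin> P"
    using primeideal.I_prime[OF P, of s t] by (auto dest: fg_ideal_closed)
  then show "fg_at P (prod_module M N)"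
    using fg_ideal_prod[OF M N s(1) t(1)] unfolding fg_at_def by blast
qed

lemma fg_at_cong:
  assumes P: "primeideal P R" and L: "module R L" and M: "module R M"
    and f: "linear_map R L M f" and g: "linear_map R M L g" and r: "r \<in> carrier R - P"
    and fg: "\<And>x. x \<in> carrier M \<Longrightarrow> f (g x) = r \<odot>\<^bsub>M\<^esub> x"
    and gf: "\<And>y. y \<in> carrier L \<Longrightarrow> g (f y) = r \<odot>\<^bsub>L\<^esub> y"
  shows "fg_at P L \<longleftrightarrow> fg_at P M"
proof
  show "fg_at P L \<Longrightarrow> fg_at P M"
    by (rule fg_at_linear_image[OF P M f r]) (metis fg imageI linear_map_closed[OF g])
  show "fg_at P M \<Longrightarrow> fg_at P L"
    by (rule fg_at_linear_image[OF P L g r]) (metis gf imageI linear_map_closed[OF f])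
qed

end

section \<open>Localization and comparability of elements\<close>

locale mult_submonoid = cring R + S: submonoid S R for R :: "'a ring" (structure) and S
begin

definition frac :: "'a \<Rightarrow> 'a \<Rightarrow> ('a \<times> 'a) set" where
  "frac r s = loc_rel R S `` {(r, s)}"

lemma loc_rel_iff:
  assumes "r \<in> carrier R" "s \<in> S" "r' \<in> carrier R" "s' \<in> S"
  shows "((r, s), (r', s')) \<in> loc_rel R S \<longleftrightarrow> (\<exists>t\<in>S. t \<otimes> (r \<otimes> s') = t \<otimes> (r' \<otimes> s))"
proof -
  have "t \<otimes> (r \<otimes> s' \<ominus> r' \<otimes> s) = \<zero> \<longleftrightarrow> t \<otimes> (r \<otimes> s') = t \<otimes> (r' \<otimes> s)" if "t \<in> S" for t
  proof -
    have "t \<otimes> (r \<otimes> s' \<ominus> r' \<otimes> s) = t \<otimes> (r \<otimes> s') \<ominus> t \<otimes> (r' \<otimes> s)"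
      using assms that S.mem_carrier by algebra
    then show ?thesis
      using assms that by simp
  qed
  then show ?thesis
    using assms by (auto simp: loc_rel_def)
qed

lemma equiv_loc_rel: "equiv (carrier R \<times> S) (loc_rel R S)"
proof (rule equivI)
  show "loc_rel R S \<subseteq> (carrier R \<times> S) \<times> (carrier R \<times> S)"
    by (auto simp: loc_rel_def)
  show "refl_on (carrier R \<times> S) (loc_rel R S)"
    using S.one_closed by (auto simp: refl_on_def loc_rel_iff)
  show "sym (loc_rel R S)"
  proof (rule symI, clarify)
    fix a s b t assume ab: "((a, s), (b, t)) \<in> loc_rel R S"
    then have mem: "a \<in> carrier R" "s \<in> S" "b \<in> carrier R" "t \<in> S"
      by (auto simp: loc_rel_def)
    then obtain v where "v \<in> S" "v \<otimes> (b \<otimes> s) = v \<otimes> (a \<otimes> t)"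
      using ab unfolding loc_rel_iff[OF mem] by metis
    then show "((b, t), (a, s)) \<in> loc_rel R S"
      using mem by (auto simp: loc_rel_iff)
  qed
  show "trans (loc_rel R S)"
  proof (rule transI, clarify)
    fix a s b t c u
    assume ab: "((a, s), (b, t)) \<in> loc_rel R S" and bc: "((b, t), (c, u)) \<in> loc_rel R S"
    then have mem: "a \<in> carrier R" "s \<in> S" "b \<in> carrier R" "t \<in> S" "c \<in> carrier R" "u \<in> S"
      by (auto simp: loc_rel_def)
    obtain v where v: "v \<in> S" "v \<otimes> (a \<otimes> t) = v \<otimes> (b \<otimes> s)"
      using ab mem by (auto simp: loc_rel_iff)
    obtain w where w: "w \<in> S" "w \<otimes> (b \<otimes> u) = w \<otimes> (c \<otimes> t)"
      using bc mem by (auto simp: loc_rel_iff)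
    note carr = mem(1,3,5) mem(2,4,6)[THEN S.mem_carrier] v(1)[THEN S.mem_carrier]
      w(1)[THEN S.mem_carrier]
    have "(v \<otimes> w \<otimes> t) \<otimes> (a \<otimes> u) = w \<otimes> u \<otimes> (v \<otimes> (a \<otimes> t))"
      using carr by algebra
    also have "\<dots> = v \<otimes> s \<otimes> (w \<otimes> (b \<otimes> u))"
      unfolding v(2) using carr by algebra
    also have "\<dots> = (v \<otimes> w \<otimes> t) \<otimes> (c \<otimes> s)"
      unfolding w(2) using carr by algebra
    finally show "((a, s), (c, u)) \<in> loc_rel R S"
      using mem v w by (auto simp: loc_rel_iff intro!: bexI[of _ "v \<otimes> w \<otimes> t"])
  qed
qed

lemma frac_eq_iff:
  assumes "r \<in> carrier R" "s \<in> S" "r' \<in> carrier R" "s' \<in> S"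
  shows "frac r s = frac r' s' \<longleftrightarrow> (\<exists>t\<in>S. t \<otimes> (r \<otimes> s') = t \<otimes> (r' \<otimes> s))"
  using eq_equiv_class_iff[OF equiv_loc_rel, of "(r, s)" "(r', s')"] assms
  by (simp add: frac_def loc_rel_iff)

lemma frac_self:
  assumes "r \<in> carrier R" "s \<in> S"
  shows "(r, s) \<in> frac r s"
  using assms equiv_class_self[OF equiv_loc_rel] by (simp add: frac_def)

lemma frac_memE:
  assumes "(a, b) \<in> frac r s"
  obtains t where "t \<in> S" "t \<otimes> (a \<otimes> s) = t \<otimes> (r \<otimes> b)"
    and "r \<in> carrier R" "s \<in> S" "a \<in> carrier R" "b \<in> S"
proof -
  have rel: "((r, s), (a, b)) \<in> loc_rel R S" using assms by (simp add: frac_def)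
  then have mem: "r \<in> carrier R" "s \<in> S" "a \<in> carrier R" "b \<in> S"
    by (auto simp: loc_rel_def)
  then obtain t where "t \<in> S" "t \<otimes> (a \<otimes> s) = t \<otimes> (r \<otimes> b)"
    using rel unfolding loc_rel_iff[OF mem] by metis
  then show ?thesis
    using that mem by blast
qed

lemma carrier_localization:
  "carrier (localization R S) = {frac r s | r s. r \<in> carrier R \<and> s \<in> S}"
  unfolding localization_def quotient_def frac_def by auto

lemma frac_closed: "\<lbrakk>r \<in> carrier R; s \<in> S\<rbrakk> \<Longrightarrow> frac r s \<in> carrier (localization R S)"
  by (auto simp: carrier_localization)

lemma localizationE:
  assumes "x \<in> carrier (localization R S)"
  obtains r s where "r \<in> carrier R" "s \<in> S" "x = frac r s"
  using assms by (auto simp: carrier_localization)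

lemma frac_binop:
  assumes mem: "r \<in> carrier R" "s \<in> S" "r' \<in> carrier R" "s' \<in> S"
    and closed: "\<And>a b a' b'.
      \<lbrakk>a \<in> carrier R; b \<in> S; a' \<in> carrier R; b' \<in> S\<rbrakk> \<Longrightarrow> h a b a' b' \<in> carrier R"
    and well_defined: "\<And>a b a' b' t t'.
      \<lbrakk>a \<in> carrier R; b \<in> S; a' \<in> carrier R; b' \<in> S; t \<in> S; t' \<in> S;
        t \<otimes> (a \<otimes> s) = t \<otimes> (r \<otimes> b); t' \<otimes> (a' \<otimes> s') = t' \<otimes> (r' \<otimes> b')\<rbrakk> \<Longrightarrow>
      (t \<otimes> t') \<otimes> (h a b a' b' \<otimes> (s \<otimes> s')) = (t \<otimes> t') \<otimes> (h r s r' s' \<otimes> (b \<otimes> b'))"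
  shows "{z. \<exists>a b a' b'. (a, b) \<in> frac r s \<and> (a', b') \<in> frac r' s' \<and>
      (z, (h a b a' b', b \<otimes> b')) \<in> loc_rel R S} = frac (h r s r' s') (s \<otimes> s')"
proof -
  have "frac (h a b a' b') (b \<otimes> b') = frac (h r s r' s') (s \<otimes> s')"
    if ab: "(a, b) \<in> frac r s" and ab': "(a', b') \<in> frac r' s'" for a b a' b'
  proof -
    obtain t where t: "t \<in> S" "t \<otimes> (a \<otimes> s) = t \<otimes> (r \<otimes> b)" "a \<in> carrier R" "b \<in> S"
      using frac_memE[OF ab] .
    obtain t' where t': "t' \<in> S" "t' \<otimes> (a' \<otimes> s') = t' \<otimes> (r' \<otimes> b')" "a' \<in> carrier R" "b' \<in> S"
      using frac_memE[OF ab'] .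
    show ?thesis
      using well_defined[OF t(3,4) t'(3,4) t(1) t'(1) t(2) t'(2)] mem t t' closed
      by (subst frac_eq_iff) (auto intro!: bexI[of _ "t \<otimes> t'"])
  qed
  moreover have "(z, (n, d)) \<in> loc_rel R S \<longleftrightarrow> z \<in> frac n d" for z n d
    using equiv_loc_rel by (auto simp: frac_def equiv_def sym_def)
  ultimately show ?thesis
    using frac_self[OF mem(1,2)] frac_self[OF mem(3,4)] by blast
qed

lemma localization_mult:
  assumes "r \<in> carrier R" "s \<in> S" "r' \<in> carrier R" "s' \<in> S"
  shows "frac r s \<otimes>\<^bsub>localization R S\<^esub> frac r' s' = frac (r \<otimes> r') (s \<otimes> s')"
proof -
  have "{z. \<exists>a b a' b'. (a, b) \<in> frac r s \<and> (a', b') \<in> frac r' s' \<and>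
      (z, (a \<otimes> a', b \<otimes> b')) \<in> loc_rel R S} = frac (r \<otimes> r') (s \<otimes> s')"
  proof (rule frac_binop[OF assms])
    fix a b a' b' t t'
    assume mem: "a \<in> carrier R" "b \<in> S" "a' \<in> carrier R" "b' \<in> S" "t \<in> S" "t' \<in> S"
      and eq: "t \<otimes> (a \<otimes> s) = t \<otimes> (r \<otimes> b)" and eq': "t' \<otimes> (a' \<otimes> s') = t' \<otimes> (r' \<otimes> b')"
    note carr = assms(1,3) assms(2,4)[THEN S.mem_carrier] mem(1,3) mem(2,4,5,6)[THEN S.mem_carrier]
    have "(t \<otimes> t') \<otimes> (a \<otimes> a' \<otimes> (s \<otimes> s')) = (t \<otimes> (a \<otimes> s)) \<otimes> (t' \<otimes> (a' \<otimes> s'))"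
      using carr by algebra
    also have "\<dots> = (t \<otimes> t') \<otimes> (r \<otimes> r' \<otimes> (b \<otimes> b'))"
      unfolding eq eq' using carr by algebra
    finally show "(t \<otimes> t') \<otimes> (a \<otimes> a' \<otimes> (s \<otimes> s')) = (t \<otimes> t') \<otimes> (r \<otimes> r' \<otimes> (b \<otimes> b'))" .
  qed simp
  then show ?thesis by (simp add: localization_def)
qed

lemma localization_add:
  assumes "r \<in> carrier R" "s \<in> S" "r' \<in> carrier R" "s' \<in> S"
  shows "frac r s \<oplus>\<^bsub>localization R S\<^esub> frac r' s' = frac (r \<otimes> s' \<oplus> r' \<otimes> s) (s \<otimes> s')"
proof -
  have "{z. \<exists>a b a' b'. (a, b) \<in> frac r s \<and> (a', b') \<in> frac r' s' \<and>
      (z, (a \<otimes> b' \<oplus> a' \<otimes> b, b \<otimes> b')) \<in> loc_rel R S} = frac (r \<otimes> s' \<oplus> r' \<otimes> s) (s \<otimes> s')"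
  proof (rule frac_binop[OF assms])
    fix a b a' b' t t'
    assume mem: "a \<in> carrier R" "b \<in> S" "a' \<in> carrier R" "b' \<in> S" "t \<in> S" "t' \<in> S"
      and eq: "t \<otimes> (a \<otimes> s) = t \<otimes> (r \<otimes> b)" and eq': "t' \<otimes> (a' \<otimes> s') = t' \<otimes> (r' \<otimes> b')"
    note carr = assms(1,3) assms(2,4)[THEN S.mem_carrier] mem(1,3) mem(2,4,5,6)[THEN S.mem_carrier]
    have "(t \<otimes> t') \<otimes> ((a \<otimes> b' \<oplus> a' \<otimes> b) \<otimes> (s \<otimes> s'))
        = t' \<otimes> b' \<otimes> s' \<otimes> (t \<otimes> (a \<otimes> s)) \<oplus> t \<otimes> b \<otimes> s \<otimes> (t' \<otimes> (a' \<otimes> s'))"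
      using carr by algebra
    also have "\<dots> = (t \<otimes> t') \<otimes> ((r \<otimes> s' \<oplus> r' \<otimes> s) \<otimes> (b \<otimes> b'))"
      unfolding eq eq' using carr by algebra
    finally show "(t \<otimes> t') \<otimes> ((a \<otimes> b' \<oplus> a' \<otimes> b) \<otimes> (s \<otimes> s'))
        = (t \<otimes> t') \<otimes> ((r \<otimes> s' \<oplus> r' \<otimes> s) \<otimes> (b \<otimes> b'))" .
  qed simp
  then show ?thesis by (simp add: localization_def)
qed

lemma localization_one: "\<one>\<^bsub>localization R S\<^esub> = frac \<one> \<one>"
  and localization_zero: "\<zero>\<^bsub>localization R S\<^esub> = frac \<zero> \<one>"
  by (simp_all add: localization_def frac_def)

lemma frac_cancel:
  assumes "r \<in> carrier R" "s \<in> S" "t \<in> S"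
  shows "frac (r \<otimes> t) (s \<otimes> t) = frac r s"
proof -
  have "\<one> \<otimes> (r \<otimes> t \<otimes> s) = \<one> \<otimes> (r \<otimes> (s \<otimes> t))"
    using assms(1) assms(2,3)[THEN S.mem_carrier] by algebra
  then show ?thesis
    using assms S.one_closed by (subst frac_eq_iff) auto
qed

lemma cring_localization: "cring (localization R S)"
proof (intro cringI abelian_groupI comm_monoidI)
  let ?L = "localization R S"
  note simps = localization_mult localization_add localization_one localization_zero frac_closed
  fix x y z
  assume x: "x \<in> carrier ?L" and y: "y \<in> carrier ?L"
  obtain a s where a: "a \<in> carrier R" "s \<in> S" "x = frac a s" using localizationE[OF x] .
  obtain b t where b: "b \<in> carrier R" "t \<in> S" "y = frac b t" using localizationE[OF y] .
  show "x \<oplus>\<^bsub>?L\<^esub> y \<in> carrier ?L" "x \<otimes>\<^bsub>?L\<^esub> y \<in> carrier ?L"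
    using a b by (simp_all add: simps)
  show "x \<oplus>\<^bsub>?L\<^esub> y = y \<oplus>\<^bsub>?L\<^esub> x" "x \<otimes>\<^bsub>?L\<^esub> y = y \<otimes>\<^bsub>?L\<^esub> x"
    using a b by (simp_all add: simps m_comm a_comm)
  show "\<zero>\<^bsub>?L\<^esub> \<oplus>\<^bsub>?L\<^esub> x = x" "\<one>\<^bsub>?L\<^esub> \<otimes>\<^bsub>?L\<^esub> x = x"
    using a by (simp_all add: simps)
  have "\<ominus> a \<otimes> s \<oplus> a \<otimes> s = \<zero>" using a(1) S.mem_carrier[OF a(2)] by algebra
  moreover have "frac \<zero> (s \<otimes> s) = frac \<zero> \<one>"
    using a S.one_closed by (subst frac_eq_iff) auto
  ultimately show "\<exists>y\<in>carrier ?L. y \<oplus>\<^bsub>?L\<^esub> x = \<zero>\<^bsub>?L\<^esub>"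
    using a by (intro bexI[of _ "frac (\<ominus> a) s"]) (simp_all add: simps)
  assume z: "z \<in> carrier ?L"
  obtain c u where c: "c \<in> carrier R" "u \<in> S" "z = frac c u" using localizationE[OF z] .
  note carr = a(1) b(1) c(1) a(2)[THEN S.mem_carrier] b(2)[THEN S.mem_carrier]
    c(2)[THEN S.mem_carrier]
  show "x \<otimes>\<^bsub>?L\<^esub> y \<otimes>\<^bsub>?L\<^esub> z = x \<otimes>\<^bsub>?L\<^esub> (y \<otimes>\<^bsub>?L\<^esub> z)"
    using a b c by (simp add: simps m_assoc)
  have "(a \<otimes> t \<oplus> b \<otimes> s) \<otimes> u \<oplus> c \<otimes> (s \<otimes> t) = a \<otimes> (t \<otimes> u) \<oplus> (b \<otimes> u \<oplus> c \<otimes> t) \<otimes> s"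
    using carr by algebra
  then show "x \<oplus>\<^bsub>?L\<^esub> y \<oplus>\<^bsub>?L\<^esub> z = x \<oplus>\<^bsub>?L\<^esub> (y \<oplus>\<^bsub>?L\<^esub> z)"
    using a b c by (simp add: simps m_assoc)
  have "a \<otimes> c \<otimes> (t \<otimes> u) \<oplus> b \<otimes> c \<otimes> (s \<otimes> u) = (a \<otimes> t \<oplus> b \<otimes> s) \<otimes> c \<otimes> u"
    "s \<otimes> u \<otimes> (t \<otimes> u) = s \<otimes> t \<otimes> u \<otimes> u"
    using carr by algebra+
  then show "(x \<oplus>\<^bsub>?L\<^esub> y) \<otimes>\<^bsub>?L\<^esub> z = x \<otimes>\<^bsub>?L\<^esub> z \<oplus>\<^bsub>?L\<^esub> y \<otimes>\<^bsub>?L\<^esub> z"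
    using a b c frac_cancel[of "(a \<otimes> t \<oplus> b \<otimes> s) \<otimes> c" "s \<otimes> t \<otimes> u" u]
    by (simp add: simps)
qed (auto simp: localization_one localization_zero frac_closed)

lemma cgenideal_frac_subsetD:
  assumes x: "x \<in> carrier R" and y: "y \<in> carrier R"
    and subset: "PIdl\<^bsub>localization R S\<^esub> (frac x \<one>) \<subseteq> PIdl\<^bsub>localization R S\<^esub> (frac y \<one>)"
  shows "\<exists>s\<in>S. \<exists>r\<in>carrier R. s \<otimes> x = r \<otimes> y"
proof -
  let ?L = "localization R S"
  interpret L: cring ?L by (rule cring_localization)
  have "frac x \<one> \<in> PIdl\<^bsub>?L\<^esub> (frac y \<one>)"
    using subset L.cgenideal_self[OF frac_closed[OF x S.one_closed]] by blast
  then obtain z where z: "z \<in> carrier ?L" "frac x \<one> = z \<otimes>\<^bsub>?L\<^esub> frac y \<one>"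
    by (auto simp: cgenideal_def)
  obtain r s where rs: "r \<in> carrier R" "s \<in> S" "z = frac r s"
    using localizationE[OF z(1)] .
  have "frac x \<one> = frac (r \<otimes> y) s"
    using z(2) rs y by (simp add: localization_mult)
  then obtain t where t: "t \<in> S" "t \<otimes> (x \<otimes> s) = t \<otimes> (r \<otimes> y)"
    using rs x y by (auto simp: frac_eq_iff)
  have "t \<otimes> s \<otimes> x = t \<otimes> r \<otimes> y"
    using t rs x y by (simp add: m_ac)
  then show ?thesis
    using t rs by (intro bexI[of _ "t \<otimes> s"] bexI[of _ "t \<otimes> r"]) auto
qed

lemma valuation_ring_localization_comparable:
  assumes val: "valuation_ring (localization R S)" and "a \<in> carrier R" "b \<in> carrier R"
  shows "(\<exists>s\<in>S. \<exists>r\<in>carrier R. s \<otimes> a = r \<otimes> b) \<or> (\<exists>s\<in>S. \<exists>r\<in>carrier R. s \<otimes> b = r \<otimes> a)"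
proof -
  let ?I = "\<lambda>x. PIdl\<^bsub>localization R S\<^esub> (frac x \<one>)"
  have "ideal (?I a) (localization R S)" "ideal (?I b) (localization R S)"
    using assms by (auto intro!: cring.cgenideal_ideal[OF cring_localization] frac_closed)
  then have "?I a \<subseteq> ?I b \<or> ?I b \<subseteq> ?I a"
    using val unfolding valuation_ring_def by blast
  then show ?thesis
    using cgenideal_frac_subsetD assms(2,3) by blast
qed

end

lemma (in primeideal) submonoid_compl: "submonoid (carrier R - I) R"
  by (rule submonoid.intro) (auto simp: one_notin dest: I_prime)

context plain_cring
begin

definition locally_dvd :: "'a set \<Rightarrow> 'a \<Rightarrow> 'a \<Rightarrow> bool" where
  "locally_dvd P a b \<longleftrightarrow> (\<exists>s\<in>carrier R - P. \<exists>r\<in>carrier R. s \<otimes> b = r \<otimes> a)"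

lemma locally_dvd_linear:
  assumes "arithmetic_ring R" "maximalideal P R" "a \<in> carrier R" "b \<in> carrier R"
  shows "locally_dvd P a b \<or> locally_dvd P b a"
proof -
  have "submonoid (carrier R - P) R"
    by (rule primeideal.submonoid_compl[OF maximalideal_prime[OF assms(2)]])
  moreover have "valuation_ring (localization R (carrier R - P))"
    using assms(1,2) by (simp add: arithmetic_ring_def localization_at_def)
  ultimately show ?thesis
    using mult_submonoid.valuation_ring_localization_comparable[OF mult_submonoid.intro[OF is_cring]
        _ assms(3,4)]
    unfolding locally_dvd_def by metis
qed

lemma locally_dvd_refl:
  assumes "primeideal P R"
  shows "locally_dvd P a a"
  using primeideal.one_notin[OF assms] unfolding locally_dvd_def by blast

lemma locally_dvd_trans:
  assumes P: "primeideal P R" and carr: "a \<in> carrier R" "b \<in> carrier R" "c \<in> carrier R"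
    and "locally_dvd P a b" "locally_dvd P b c"
  shows "locally_dvd P a c"
proof -
  obtain s r where s: "s \<in> carrier R - P" "r \<in> carrier R" "s \<otimes> b = r \<otimes> a"
    using assms(5) unfolding locally_dvd_def by blast
  obtain t q where t: "t \<in> carrier R - P" "q \<in> carrier R" "t \<otimes> c = q \<otimes> b"
    using assms(6) unfolding locally_dvd_def by blast
  have "s \<otimes> t \<otimes> c = s \<otimes> (t \<otimes> c)" using s t carr by (simp add: m_assoc)
  also have "\<dots> = q \<otimes> (s \<otimes> b)" using s t carr by (simp add: m_lcomm)
  also have "\<dots> = q \<otimes> r \<otimes> a" using s t carr by (simp add: m_assoc)
  finally have "s \<otimes> t \<otimes> c = q \<otimes> r \<otimes> a" .
  moreover have "s \<otimes> t \<in> carrier R - P"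
    using submonoid.m_closed[OF primeideal.submonoid_compl[OF P]] s(1) t(1) by blast
  ultimately show ?thesis
    using s(2) t(2) unfolding locally_dvd_def by blast
qed

lemma exists_locally_dvd_all:
  assumes P: "primeideal P R" and "finite K" "K \<noteq> {}" and a: "a \<in> K \<rightarrow> carrier R"
    and linear: "\<And>x y. \<lbrakk>x \<in> carrier R; y \<in> carrier R\<rbrakk> \<Longrightarrow> locally_dvd P x y \<or> locally_dvd P y x"
  shows "\<exists>m\<in>K. \<forall>k\<in>K. locally_dvd P (a m) (a k)"
  using assms(2-4)
proof (induction rule: finite_ne_induct)
  case (singleton k)
  show ?case using locally_dvd_refl[OF P] by simp
next
  case (insert l K)
  then obtain m where m: "m \<in> K" "\<forall>k\<in>K. locally_dvd P (a m) (a k)" by blast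
  have carr: "a k \<in> carrier R" if "k \<in> insert l K" for k using insert.prems that by blast
  then consider (old) "locally_dvd P (a m) (a l)" | (new) "locally_dvd P (a l) (a m)"
    using linear m(1) by blast
  then show ?case
  proof cases
    case old
    then show ?thesis using m by blast
  next
    case new
    have "locally_dvd P (a l) (a k)" if "k \<in> K" for k
      using locally_dvd_trans[OF P carr carr carr new] m that by blast
    then show ?thesis using locally_dvd_refl[OF P] by blast
  qed
qed

lemma locally_dvd_common_denominator:
  assumes P: "primeideal P R" and "finite K" "a \<in> K \<rightarrow> carrier R" "b \<in> carrier R"
    and "\<And>k. k \<in> K \<Longrightarrow> locally_dvd P b (a k)"
  shows "\<exists>s\<in>carrier R - P. \<forall>k\<in>K. \<exists>r\<in>carrier R. s \<otimes> a k = r \<otimes> b"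
  using assms(2,3,5)
proof (induction rule: finite_induct)
  case empty
  then show ?case using primeideal.one_notin[OF P] by blast
next
  case (insert l K)
  then obtain s where s: "s \<in> carrier R - P" "\<And>k. k \<in> K \<Longrightarrow> \<exists>r\<in>carrier R. s \<otimes> a k = r \<otimes> b"
    by blast
  obtain t q where t: "t \<in> carrier R - P" "q \<in> carrier R" "t \<otimes> a l = q \<otimes> b"
    using insert.prems(2) unfolding locally_dvd_def by blast
  have "\<exists>r\<in>carrier R. s \<otimes> t \<otimes> a k = r \<otimes> b" if k: "k \<in> insert l K" for k
  proof (cases "k = l")
    case True
    have "s \<otimes> t \<otimes> a l = s \<otimes> q \<otimes> b"
      using s(1) t insert.prems(1) assms(4) by (simp add: m_assoc)
    then show ?thesis using True s(1) t(2) by (intro bexI[of _ "s \<otimes> q"]) auto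
  next
    case False
    then obtain r where r: "r \<in> carrier R" "s \<otimes> a k = r \<otimes> b" using s(2) k by blast
    have "s \<otimes> t \<otimes> a k = t \<otimes> (s \<otimes> a k)"
      using s(1) t(1) k insert.prems(1) by (auto simp: m_ac Pi_iff)
    also have "\<dots> = t \<otimes> r \<otimes> b" using r t(1) assms(4) by (simp add: m_assoc)
    finally show ?thesis using t(1) r(1) by (intro bexI[of _ "t \<otimes> r"]) auto
  qed
  moreover have "s \<otimes> t \<in> carrier R - P"
    using submonoid.m_closed[OF primeideal.submonoid_compl[OF P]] s(1) t(1) by blast
  ultimately show ?case by blast
qed

section \<open>Gaussian elimination\<close>

abbreviation mat_kernel :: "'i set \<Rightarrow> 'j set \<Rightarrow> ('i \<Rightarrow> 'j \<Rightarrow> 'a) \<Rightarrow> ('a, 'j \<Rightarrow> 'a) module" where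
  "mat_kernel I J A \<equiv> kernel_module (vec_module R J) (vec_module R I) (mat_map I J A)"

abbreviation annihilator :: "'a \<Rightarrow> ('a, 'a) module" where
  "annihilator a \<equiv> kernel_module (self_module R) (self_module R) (\<lambda>x. a \<otimes> x)"

lemma module_mat_kernel:
  assumes "finite J" "\<And>i j. \<lbrakk>i \<in> I; j \<in> J\<rbrakk> \<Longrightarrow> A i j \<in> carrier R"
  shows "module R (mat_kernel I J A)"
  by (intro module_kernel_module module_vec_module linear_map_mat_map assms)

lemma module_annihilator:
  assumes "a \<in> carrier R"
  shows "module R (annihilator a)"
  using assms
  by (intro module_kernel_module module_self_module linear_mapI) (simp_all add: r_distr m_lcomm)

lemma lin_kernel_annihilator:
  "x \<in> lin_kernel (self_module R) (self_module R) (\<lambda>x. a \<otimes> x) \<longleftrightarrow> x \<in> carrier R \<and> a \<otimes> x = \<zero>"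
  by (simp add: lin_kernel_def)

lemma mat_kernel_no_rows: "mat_kernel {} J A = vec_module R J"
  by (simp add: kernel_module_def lin_kernel_def mat_map_def)

lemma mat_kernel_no_columns: "mat_kernel I {} A = vec_module R {}"
  by (auto simp: kernel_module_def lin_kernel_def mat_map_def dot_def vec_module_def)

lemma fg_at_vec_module:
  assumes "primeideal P R" "finite J"
  shows "fg_at P (vec_module R J)"
  by (rule one_in_fg_ideal_imp_fg_at[OF assms(1) one_in_fg_ideal_vec_module[OF assms(2)]])

lemma mat_kernel_cong:
  assumes "\<And>i j. \<lbrakk>i \<in> I; j \<in> J\<rbrakk> \<Longrightarrow> A i j = B i j" "\<And>i j. \<lbrakk>i \<in> I; j \<in> J\<rbrakk> \<Longrightarrow> B i j \<in> carrier R"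
  shows "mat_kernel I J A = mat_kernel I J B"
proof -
  have "dot J (A i) x = dot J (B i) x" if "i \<in> I" "x \<in> carrier (vec_module R J)" for i x
    using assms that vec_closed[OF that(2)] by (intro dot_cong) auto
  then have "lin_kernel (vec_module R J) (vec_module R I) (mat_map I J A) =
      lin_kernel (vec_module R J) (vec_module R I) (mat_map I J B)"
    by (auto simp: lin_kernel_mat_map)
  then show ?thesis by (simp add: kernel_module_def)
qed

end

locale pivot = plain_cring R for R :: "'a ring" (structure) +
  fixes A c :: "'i \<Rightarrow> 'j \<Rightarrow> 'a" and I :: "'i set" and J :: "'j set" and p q s
  assumes finite_I: "finite I" and finite_J: "finite J" and p: "p \<in> I" and q: "q \<in> J"
    and A_closed: "\<lbrakk>i \<in> I; j \<in> J\<rbrakk> \<Longrightarrow> A i j \<in> carrier R"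
    and c_closed: "\<lbrakk>i \<in> I; j \<in> J\<rbrakk> \<Longrightarrow> c i j \<in> carrier R"
    and c_pivot: "c p q = s"
    and pivot_eq: "\<lbrakk>i \<in> I; j \<in> J\<rbrakk> \<Longrightarrow> s \<otimes> A i j = c i j \<otimes> A p q"
begin

lemma s_closed: "s \<in> carrier R"
  using c_closed[OF p q] c_pivot by simp

text \<open>Up to multiplication by \<open>s\<^sup>2\<close>, the kernel of \<open>A\<close> is the product of the annihilator of the
  pivot and the kernel of this Schur complement, whose formula is symmetric in rows and columns.\<close>

definition schur :: "'i \<Rightarrow> 'j \<Rightarrow> 'a" where
  "schur i j = (s \<otimes> c i j \<ominus> c i q \<otimes> c p j) \<otimes> A p q"

lemma schur_closed: "\<lbrakk>i \<in> I; j \<in> J\<rbrakk> \<Longrightarrow> schur i j \<in> carrier R"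
  using A_closed c_closed p q s_closed by (simp add: schur_def)

lemma schur_pivot_row: "j \<in> J \<Longrightarrow> schur p j = \<zero>"
  unfolding schur_def c_pivot using A_closed[OF p q] c_closed[OF p] s_closed by algebra

lemma schur_pivot_col: "i \<in> I \<Longrightarrow> schur i q = \<zero>"
  unfolding schur_def c_pivot using A_closed[OF p q] c_closed[OF _ q] s_closed by algebra

abbreviation "ker_A \<equiv> mat_kernel I J A"
abbreviation "ker_schur \<equiv> mat_kernel (I - {p}) (J - {q}) schur"
abbreviation "ann_pivot \<equiv> annihilator (A p q)"

lemma module_ker_A: "module R ker_A"
  using finite_J A_closed by (rule module_mat_kernel)

lemma module_ker_schur: "module R ker_schur"
  using finite_J schur_closed by (intro module_mat_kernel) auto

lemma module_ann_pivot: "module R ann_pivot"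
  by (rule module_annihilator[OF A_closed[OF p q]])

lemma linear_map_dot_pivot_row:
  "linear_map R (vec_module R (J - {q})) (self_module R) (dot (J - {q}) (c p))"
  using finite_J c_closed[OF p] by (intro linear_map_dot) auto

lemma dot_pivot_row_closed: "(\<And>j. x j \<in> carrier R) \<Longrightarrow> dot (J - {q}) (c p) x \<in> carrier R"
  using c_closed[OF p] by (intro dot_closed) auto

definition reduce :: "('j \<Rightarrow> 'a) \<Rightarrow> 'a \<times> ('j \<Rightarrow> 'a)" where
  "reduce x = (dot J (c p) x, x(q := \<zero>))"

definition expand :: "'a \<times> ('j \<Rightarrow> 'a) \<Rightarrow> 'j \<Rightarrow> 'a" where
  "expand z = (\<lambda>j. if j = q then s \<otimes> fst z \<ominus> s \<otimes> dot (J - {q}) (c p) (snd z) else s \<otimes> s \<otimes> snd z j)"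

lemma linear_map_reduce:
  "linear_map R (vec_module R J) (prod_module (self_module R) (vec_module R (J - {q}))) reduce"
  unfolding reduce_def
proof (rule linear_map_pair)
  show "linear_map R (vec_module R J) (self_module R) (dot J (c p))"
    using finite_J c_closed[OF p] by (intro linear_map_dot) auto
  show "linear_map R (vec_module R J) (vec_module R (J - {q})) (\<lambda>x. x(q := \<zero>))"
    by (rule linear_mapI) (auto simp: in_vec_module_iff)
qed

lemma linear_map_expand:
  "linear_map R (prod_module (self_module R) (vec_module R (J - {q}))) (vec_module R J) expand"
proof (rule linear_mapI)
  note dot_lin = linear_mapD[OF linear_map_dot_pivot_row, simplified]
  fix y assume y: "y \<in> carrier (prod_module (self_module R) (vec_module R (J - {q})))"
  then have y': "fst y \<in> carrier R" "snd y \<in> carrier (vec_module R (J - {q}))" by auto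
  note y_closed = y'(1) vec_closed[OF y'(2)] dot_lin(1)[OF y'(2)]
  show "expand y \<in> carrier (vec_module R J)"
    using y' y_closed s_closed q by (auto simp: expand_def in_vec_module_iff)
  show "expand (a \<odot>\<^bsub>prod_module (self_module R) (vec_module R (J - {q}))\<^esub> y) =
      a \<odot>\<^bsub>vec_module R J\<^esub> expand y" if a: "a \<in> carrier R" for a
  proof -
    have "s \<otimes> (a \<otimes> u) \<ominus> s \<otimes> (a \<otimes> v) = a \<otimes> (s \<otimes> u \<ominus> s \<otimes> v)"
      if "u \<in> carrier R" "v \<in> carrier R" for u v
      using a that s_closed by algebra
    then show ?thesis
      using a y_closed s_closed dot_lin(3)[OF a y'(2)] by (auto simp: expand_def m_lcomm)
  qed
  fix z assume z: "z \<in> carrier (prod_module (self_module R) (vec_module R (J - {q})))"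
  then have z': "fst z \<in> carrier R" "snd z \<in> carrier (vec_module R (J - {q}))" by auto
  note z_closed = z'(1) vec_closed[OF z'(2)] dot_lin(1)[OF z'(2)]
  have "s \<otimes> (u \<oplus> u') \<ominus> s \<otimes> (v \<oplus> v') = (s \<otimes> u \<ominus> s \<otimes> v) \<oplus> (s \<otimes> u' \<ominus> s \<otimes> v')"
    if "u \<in> carrier R" "v \<in> carrier R" "u' \<in> carrier R" "v' \<in> carrier R" for u v u' v'
    using that s_closed by algebra
  then show "expand (y \<oplus>\<^bsub>prod_module (self_module R) (vec_module R (J - {q}))\<^esub> z)
      = expand y \<oplus>\<^bsub>vec_module R J\<^esub> expand z"
    using y_closed z_closed s_closed dot_lin(2)[OF y'(2) z'(2)] by (auto simp: expand_def r_distr)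
qed

lemma dot_schur_remove:
  assumes i: "i \<in> I" and x: "x \<in> carrier (vec_module R J)"
  shows "dot (J - {q}) (schur i) (x(q := \<zero>)) =
    (s \<otimes> s) \<otimes> dot J (A i) x \<oplus> (\<ominus> (c i q \<otimes> s)) \<otimes> dot J (A p) x"
proof -
  note x_closed = vec_closed[OF x]
  have "dot (J - {q}) (schur i) (x(q := \<zero>)) = dot (J - {q}) (schur i) x"
    using x_closed schur_closed[OF i] by (intro dot_cong) auto
  also have "\<dots> = dot J (schur i) x"
    using x_closed schur_closed[OF i]
    by (subst dot_remove[OF finite_J q]) (auto simp: schur_pivot_col[OF i] q)
  also have "\<dots> = dot J (\<lambda>j. (s \<otimes> s) \<otimes> A i j) x \<oplus> dot J (\<lambda>j. (\<ominus> (c i q \<otimes> s)) \<otimes> A p j) x"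
  proof (rule dot_add)
    fix j assume j: "j \<in> J"
    note closed = A_closed[OF i j] A_closed[OF p j] A_closed[OF p q]
      c_closed[OF i j] c_closed[OF p j] c_closed[OF i q] s_closed x_closed[of j]
    have "schur i j \<otimes> x j = (s \<otimes> (c i j \<otimes> A p q) \<ominus> c i q \<otimes> (c p j \<otimes> A p q)) \<otimes> x j"
      unfolding schur_def using closed by algebra
    also have "\<dots> = (s \<otimes> (s \<otimes> A i j) \<ominus> c i q \<otimes> (s \<otimes> A p j)) \<otimes> x j"
      using i j p by (simp add: pivot_eq)
    also have "\<dots> = ((s \<otimes> s) \<otimes> A i j) \<otimes> x j \<oplus> ((\<ominus> (c i q \<otimes> s)) \<otimes> A p j) \<otimes> x j"
      using closed by algebra
    finally show "schur i j \<otimes> x j =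
        ((s \<otimes> s) \<otimes> A i j) \<otimes> x j \<oplus> ((\<ominus> (c i q \<otimes> s)) \<otimes> A p j) \<otimes> x j" .
  qed (use x_closed A_closed i p q c_closed s_closed in auto)
  also have "dot J (\<lambda>j. (s \<otimes> s) \<otimes> A i j) x = (s \<otimes> s) \<otimes> dot J (A i) x"
    using x_closed A_closed[OF i] s_closed by (intro dot_smult finite_J) (auto simp: m_assoc)
  also have "dot J (\<lambda>j. (\<ominus> (c i q \<otimes> s)) \<otimes> A p j) x = (\<ominus> (c i q \<otimes> s)) \<otimes> dot J (A p) x"
    using x_closed A_closed[OF p] c_closed[OF i q] s_closed
    by (intro dot_smult finite_J) (auto simp: m_assoc)
  finally show ?thesis .
qed

lemma pivot_mult_dot:
  assumes i: "i \<in> I" and x: "x \<in> carrier (vec_module R J)"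
  shows "A p q \<otimes> dot J (c i) x = s \<otimes> dot J (A i) x"
proof -
  have "dot J (\<lambda>j. s \<otimes> A i j) x = A p q \<otimes> dot J (c i) x"
    using vec_closed[OF x] A_closed[OF p q] c_closed[OF i]
    by (intro dot_smult finite_J) (auto simp: pivot_eq[OF i] m_ac)
  moreover have "dot J (\<lambda>j. s \<otimes> A i j) x = s \<otimes> dot J (A i) x"
    using vec_closed[OF x] A_closed[OF i] s_closed
    by (intro dot_smult finite_J) (auto simp: m_assoc)
  ultimately show ?thesis by simp
qed

lemma dot_expand_off_pivot:
  assumes i: "i \<in> I" and w: "w \<in> carrier (vec_module R (J - {q}))"
  shows "dot (J - {q}) (A i) (expand (v, w)) =
    dot (J - {q}) (schur i) w \<oplus> (c i q \<otimes> A p q) \<otimes> dot (J - {q}) (c p) w"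
proof -
  note w_closed = vec_closed[OF w]
  have "dot (J - {q}) (A i) (expand (v, w)) =
      dot (J - {q}) (schur i) w \<oplus> dot (J - {q}) (\<lambda>j. (c i q \<otimes> A p q) \<otimes> c p j) w"
  proof (rule dot_add)
    fix j assume j: "j \<in> J - {q}"
    then have jJ: "j \<in> J" by simp
    note closed = A_closed[OF i jJ] A_closed[OF p q] c_closed[OF i jJ] c_closed[OF p jJ]
      c_closed[OF i q] s_closed w_closed[of j]
    have "A i j \<otimes> expand (v, w) j = (s \<otimes> A i j) \<otimes> (s \<otimes> w j)"
      using j closed by (simp add: expand_def m_ac)
    also have "\<dots> = (c i j \<otimes> A p q) \<otimes> (s \<otimes> w j)"
      by (simp only: pivot_eq[OF i jJ])
    also have "\<dots> = schur i j \<otimes> w j \<oplus> ((c i q \<otimes> A p q) \<otimes> c p j) \<otimes> w j"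
      unfolding schur_def using closed by algebra
    finally show "A i j \<otimes> expand (v, w) j = schur i j \<otimes> w j \<oplus> ((c i q \<otimes> A p q) \<otimes> c p j) \<otimes> w j" .
  qed (use w_closed A_closed schur_closed c_closed i p q in auto)
  also have "dot (J - {q}) (\<lambda>j. (c i q \<otimes> A p q) \<otimes> c p j) w =
      (c i q \<otimes> A p q) \<otimes> dot (J - {q}) (c p) w"
    using w_closed A_closed[OF p q] c_closed i p q finite_J
    by (intro dot_smult) (auto simp: m_assoc)
  finally show ?thesis .
qed

lemma dot_expand:
  assumes i: "i \<in> I" and v: "v \<in> carrier R" and w: "w \<in> carrier (vec_module R (J - {q}))"
  shows "dot J (A i) (expand (v, w)) = c i q \<otimes> (A p q \<otimes> v) \<oplus> dot (J - {q}) (schur i) w"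
proof -
  let ?d = "dot (J - {q}) (c p) w" and ?S = "dot (J - {q}) (schur i) w"
  have S: "?S \<in> carrier R"
    using vec_closed[OF w] schur_closed[OF i] by (intro dot_closed) auto
  note closed = A_closed[OF i q] A_closed[OF p q] c_closed[OF i q] s_closed v
    dot_pivot_row_closed[of w, OF vec_closed[OF w]]
  have "expand (v, w) \<in> carrier (vec_module R J)"
    using linear_map_closed[OF linear_map_expand, of "(v, w)"] v w by simp
  then have "dot J (A i) (expand (v, w)) =
      A i q \<otimes> expand (v, w) q \<oplus> (?S \<oplus> (c i q \<otimes> A p q) \<otimes> ?d)"
    using A_closed[OF i] vec_closed
    by (subst dot_remove[OF finite_J q]) (auto simp: dot_expand_off_pivot[OF i w])
  also have "A i q \<otimes> expand (v, w) q = (s \<otimes> A i q) \<otimes> (v \<ominus> ?d)"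
    unfolding expand_def using closed by simp algebra
  also have "\<dots> = (c i q \<otimes> A p q) \<otimes> (v \<ominus> ?d)"
    by (simp only: pivot_eq[OF i q])
  also have "\<dots> \<oplus> (?S \<oplus> (c i q \<otimes> A p q) \<otimes> ?d) = c i q \<otimes> (A p q \<otimes> v) \<oplus> ?S"
    using closed S by algebra
  finally show ?thesis .
qed

lemma linear_map_reduce_kernel: "linear_map R ker_A (prod_module ann_pivot ker_schur) reduce"
proof -
  have "reduce x \<in> carrier (prod_module ann_pivot ker_schur)" if x: "x \<in> carrier ker_A" for x
  proof -
    have xv: "x \<in> carrier (vec_module R J)" and x0: "\<And>i. i \<in> I \<Longrightarrow> dot J (A i) x = \<zero>"
      using x by (simp_all add: lin_kernel_mat_map)
    have "A p q \<otimes> dot J (c p) x = \<zero>"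
      using pivot_mult_dot[OF p xv] x0[OF p] s_closed by simp
    moreover have "dot (J - {q}) (schur i) (x(q := \<zero>)) = \<zero>" if "i \<in> I" for i
      using dot_schur_remove[OF that xv] x0 p q that s_closed c_closed by simp
    ultimately show ?thesis
      using linear_map_closed[OF linear_map_reduce xv]
      by (simp add: reduce_def lin_kernel_annihilator lin_kernel_mat_map)
  qed
  then show ?thesis
    using linear_mapD[OF linear_map_reduce] by (intro linear_mapI) (auto simp: lin_kernel_def)
qed

lemma linear_map_expand_kernel: "linear_map R (prod_module ann_pivot ker_schur) ker_A expand"
proof -
  have "expand z \<in> carrier ker_A" if z: "z \<in> carrier (prod_module ann_pivot ker_schur)" for z
  proof -
    obtain v w where vw: "z = (v, w)" "v \<in> carrier R" "A p q \<otimes> v = \<zero>"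
      "w \<in> carrier (vec_module R (J - {q}))" "\<And>i. i \<in> I - {p} \<Longrightarrow> dot (J - {q}) (schur i) w = \<zero>"
      using z by (auto simp: lin_kernel_mat_map lin_kernel_annihilator)
    have "dot (J - {q}) (schur p) w = \<zero>"
      using vec_closed[OF vw(4)] by (intro dot_zero) (simp add: schur_pivot_row)
    then have "dot J (A i) (expand z) = \<zero>" if "i \<in> I" for i
      using dot_expand[OF that vw(2,4)] vw(3,5) that c_closed[OF that q]
      by (cases "i = p") (auto simp: vw(1))
    then show ?thesis
      using linear_map_closed[OF linear_map_expand, of z] vw by (simp add: lin_kernel_mat_map)
  qed
  then show ?thesis
    using linear_mapD[OF linear_map_expand] by (intro linear_mapI) (auto simp: lin_kernel_def)
qed

lemma expand_reduce:
  assumes "x \<in> carrier (vec_module R J)"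
  shows "expand (reduce x) = (s \<otimes> s) \<odot>\<^bsub>vec_module R J\<^esub> x"
proof
  fix j
  note x_closed = vec_closed[OF assms]
  let ?d = "dot (J - {q}) (c p) x"
  note d = dot_pivot_row_closed[of x, OF x_closed]
  have "dot J (c p) x = s \<otimes> x q \<oplus> ?d"
    using finite_J q x_closed c_closed[OF p]
    by (subst dot_remove[OF finite_J q]) (auto simp: c_pivot)
  moreover have "dot (J - {q}) (c p) (x(q := \<zero>)) = ?d"
    using x_closed c_closed[OF p] by (intro dot_cong) auto
  moreover have "s \<otimes> (s \<otimes> x q \<oplus> ?d) \<ominus> s \<otimes> ?d = s \<otimes> s \<otimes> x q"
    using s_closed x_closed[of q] d by algebra
  ultimately show "expand (reduce x) j = ((s \<otimes> s) \<odot>\<^bsub>vec_module R J\<^esub> x) j"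
    by (simp add: expand_def reduce_def)
qed

lemma reduce_expand:
  assumes v: "v \<in> carrier R" and w: "w \<in> carrier (vec_module R (J - {q}))"
  shows "reduce (expand (v, w)) = (s \<otimes> s \<otimes> v, \<lambda>j. s \<otimes> s \<otimes> w j)"
proof -
  note w_closed = vec_closed[OF w]
  let ?J = "J - {q}" and ?d = "dot (J - {q}) (c p) w"
  note d = dot_pivot_row_closed[of w, OF w_closed]
  have ev: "expand (v, w) \<in> carrier (vec_module R J)"
    using linear_map_closed[OF linear_map_expand, of "(v, w)"] v w by simp
  have "dot ?J (c p) (expand (v, w)) = dot ?J (c p) ((s \<otimes> s) \<odot>\<^bsub>vec_module R ?J\<^esub> w)"
    using w_closed c_closed[OF p] s_closed by (intro dot_cong) (auto simp: expand_def)
  also have "\<dots> = (s \<otimes> s) \<otimes> ?d"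
    using linear_map_smult[OF linear_map_dot_pivot_row _ w, of "s \<otimes> s"] s_closed by simp
  finally have "dot J (c p) (expand (v, w)) = s \<otimes> (s \<otimes> v \<ominus> s \<otimes> ?d) \<oplus> (s \<otimes> s) \<otimes> ?d"
    using vec_closed[OF ev] c_closed[OF p]
    by (subst dot_remove[OF finite_J q]) (auto simp: c_pivot expand_def)
  also have "\<dots> = s \<otimes> s \<otimes> v"
    using s_closed v d by algebra
  finally show ?thesis
    using w s_closed by (auto simp: reduce_def expand_def in_vec_module_iff)
qed

lemma fg_at_ker_A_iff:
  assumes P: "primeideal P R" and s: "s \<notin> P"
  shows "fg_at P ker_A \<longleftrightarrow> fg_at P ann_pivot \<and> fg_at P ker_schur"
proof -
  have ss: "s \<otimes> s \<in> carrier R - P"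
    using primeideal.I_prime[OF P, of s s] s s_closed by auto
  have "fg_at P ker_A \<longleftrightarrow> fg_at P (prod_module ann_pivot ker_schur)"
  proof (rule fg_at_cong[OF P module_ker_A _ linear_map_reduce_kernel linear_map_expand_kernel ss])
    show "module R (prod_module ann_pivot ker_schur)"
      by (rule module_prod_module[OF module_ann_pivot module_ker_schur])
    show "expand (reduce x) = s \<otimes> s \<odot>\<^bsub>ker_A\<^esub> x" if "x \<in> carrier ker_A" for x
      using that expand_reduce[of x] by (simp add: lin_kernel_mat_map)
    show "reduce (expand z) = s \<otimes> s \<odot>\<^bsub>prod_module ann_pivot ker_schur\<^esub> z"
      if "z \<in> carrier (prod_module ann_pivot ker_schur)" for z
      using that reduce_expand[of "fst z" "snd z"] by (auto simp: lin_kernel_def)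
  qed
  then show ?thesis
    using fg_at_prod_iff[OF P module_ann_pivot module_ker_schur] by simp
qed

lemma pivot_transpose: "pivot R (\<lambda>j i. A i j) (\<lambda>j i. c i j) J I q p s"
  using pivot_eq A_closed c_closed finite_I finite_J p q c_pivot by unfold_locales auto

lemma schur_transpose:
  "\<lbrakk>i \<in> I; j \<in> J\<rbrakk> \<Longrightarrow> pivot.schur R (\<lambda>j i. A i j) (\<lambda>j i. c i j) q p s j i = schur i j"
  using c_closed[OF p, of j] c_closed[OF _ q, of i]
  by (simp add: pivot.schur_def[OF pivot_transpose] schur_def m_comm)

end

context plain_cring
begin

lemma exists_pivot:
  assumes P: "primeideal P R" and fin: "finite I" "finite J" "I \<noteq> {}" "J \<noteq> {}"
    and A: "\<And>i j. \<lbrakk>i \<in> I; j \<in> J\<rbrakk> \<Longrightarrow> A i j \<in> carrier R"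
    and linear: "\<And>x y. \<lbrakk>x \<in> carrier R; y \<in> carrier R\<rbrakk> \<Longrightarrow> locally_dvd P x y \<or> locally_dvd P y x"
  shows "\<exists>p q s c. s \<notin> P \<and> pivot R A c I J p q s"
proof -
  let ?a = "\<lambda>(i, j). A i j"
  have "?a \<in> I \<times> J \<rightarrow> carrier R" using A by auto
  moreover have "finite (I \<times> J)" "I \<times> J \<noteq> {}" using fin by auto
  ultimately obtain m where "m \<in> I \<times> J" and "\<forall>k\<in>I \<times> J. locally_dvd P (?a m) (?a k)"
    using exists_locally_dvd_all[OF P _ _ _ linear, of "I \<times> J" ?a] by blast
  then obtain p q where pq: "p \<in> I" "q \<in> J"
    and dvd: "\<And>k. k \<in> I \<times> J \<Longrightarrow> locally_dvd P (A p q) (?a k)"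
    by fastforce
  then obtain s where s: "s \<in> carrier R - P" and "\<forall>k\<in>I \<times> J. \<exists>r\<in>carrier R. s \<otimes> ?a k = r \<otimes> A p q"
    using locally_dvd_common_denominator[OF P \<open>finite (I \<times> J)\<close> \<open>?a \<in> _\<close> A[OF pq] dvd] by blast
  then obtain r where r: "\<And>k. k \<in> I \<times> J \<Longrightarrow> r k \<in> carrier R"
    "\<And>k. k \<in> I \<times> J \<Longrightarrow> s \<otimes> ?a k = r k \<otimes> A p q"
    by metis
  define c where "c i j = (if (i, j) = (p, q) then s else r (i, j))" for i j
  have "pivot R A c I J p q s"
  proof unfold_locales
    show "c i j \<in> carrier R" if "i \<in> I" "j \<in> J" for i j
      using r(1)[of "(i, j)"] that s by (auto simp: c_def)
    show "s \<otimes> A i j = c i j \<otimes> A p q" if "i \<in> I" "j \<in> J" for i j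
      using r(2)[of "(i, j)"] that by (auto simp: c_def)
  qed (use fin pq A in \<open>auto simp: c_def\<close>)
  then show ?thesis using s by blast
qed

lemma fg_at_mat_kernel_transpose_iff:
  assumes P: "primeideal P R"
    and linear: "\<And>x y. \<lbrakk>x \<in> carrier R; y \<in> carrier R\<rbrakk> \<Longrightarrow> locally_dvd P x y \<or> locally_dvd P y x"
    and "finite I" "finite J" "\<And>i j. \<lbrakk>i \<in> I; j \<in> J\<rbrakk> \<Longrightarrow> A i j \<in> carrier R"
  shows "fg_at P (mat_kernel I J A) \<longleftrightarrow> fg_at P (mat_kernel J I (\<lambda>j i. A i j))"
  using assms(3-5)
proof (induction "card I" arbitrary: I J A rule: less_induct)
  case less
  consider (no_rows) "I = {}" | (no_columns) "J = {}" | (nonempty) "I \<noteq> {}" "J \<noteq> {}" by blast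
  then show ?case
  proof cases
    case no_rows
    then show ?thesis
      by (simp only: mat_kernel_no_rows mat_kernel_no_columns fg_at_vec_module[OF P] less.prems(2)
          finite.emptyI)
  next
    case no_columns
    then show ?thesis
      by (simp only: mat_kernel_no_rows mat_kernel_no_columns fg_at_vec_module[OF P] less.prems(1)
          finite.emptyI)
  next
    case nonempty
    then have "\<exists>p q s c. s \<notin> P \<and> pivot R A c I J p q s"
      using less.prems by (intro exists_pivot[OF P _ _ _ _ _ linear]) auto
    then obtain p q s c where s: "s \<notin> P" and pivot: "pivot R A c I J p q s" by blast
    note pivot_tr = pivot.pivot_transpose[OF pivot]
    let ?schur = "pivot.schur R A c p q s"
    let ?schur_tr = "pivot.schur R (\<lambda>j i. A i j) (\<lambda>j i. c i j) q p s"
    have "fg_at P (mat_kernel (I - {p}) (J - {q}) ?schur) \<longleftrightarrow>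
        fg_at P (mat_kernel (J - {q}) (I - {p}) (\<lambda>j i. ?schur i j))"
      using less.prems(1,2) pivot.schur_closed[OF pivot]
        card_Diff1_less[OF less.prems(1) pivot.p[OF pivot]]
      by (intro less.hyps) auto
    also have "mat_kernel (J - {q}) (I - {p}) (\<lambda>j i. ?schur i j) =
        mat_kernel (J - {q}) (I - {p}) ?schur_tr"
      using pivot.schur_transpose[OF pivot] pivot.schur_closed[OF pivot]
      by (intro mat_kernel_cong) auto
    finally show ?thesis
      using pivot.fg_at_ker_A_iff[OF pivot P s] pivot.fg_at_ker_A_iff[OF pivot_tr P s] by simp
  qed
qed

end

section \<open>Quotients and extension of linear maps\<close>

definition coset_rep :: "('a, 'p) module \<Rightarrow> 'p set \<Rightarrow> 'p \<Rightarrow> 'p" where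
  "coset_rep P N v = (SOME w. w \<in> N +>\<^bsub>P\<^esub> v)"

text \<open>The quotient is carried by chosen coset representatives, so that it lives on the type of
  the original module, as the test modules of \<^const>\<open>fp_injective\<close> and \<^const>\<open>Ext1_vanishes\<close> must.\<close>

definition rep_quotient :: "('a, 'p) module \<Rightarrow> 'p set \<Rightarrow> ('a, 'p) module" where
  "rep_quotient P N =
     \<lparr> carrier = coset_rep P N ` carrier P,
       monoid.mult = (\<lambda>x y. x), one = \<zero>\<^bsub>P\<^esub>,
       ring.zero = coset_rep P N \<zero>\<^bsub>P\<^esub>,
       ring.add = (\<lambda>x y. coset_rep P N (x \<oplus>\<^bsub>P\<^esub> y)),
       module.smult = (\<lambda>a x. coset_rep P N (a \<odot>\<^bsub>P\<^esub> x)) \<rparr>"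

locale module_quotient = P: module R P for R :: "'a ring" and P :: "('a, 'p) module" +
  fixes N
  assumes N: "submodule N R P"
begin

lemma abelian_subgroup_N: "abelian_subgroup N P"
  by (intro abelian_subgroupI3 additive_subgroupI submodule.axioms(1)[OF N] P.abelian_group_axioms)

interpretation N: abelian_subgroup N P
  by (rule abelian_subgroup_N)

lemma coset_rep_in_coset:
  assumes "v \<in> carrier P"
  shows "coset_rep P N v \<in> N +>\<^bsub>P\<^esub> v"
  unfolding coset_rep_def using N.a_rcos_self[OF assms] by (rule someI)

lemma coset_rep_closed: "v \<in> carrier P \<Longrightarrow> coset_rep P N v \<in> carrier P"
  using coset_rep_in_coset N.a_subset P.a_r_coset_subset_G by blast

lemma coset_rep_coset: "v \<in> carrier P \<Longrightarrow> N +>\<^bsub>P\<^esub> coset_rep P N v = N +>\<^bsub>P\<^esub> v"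
  using P.a_repr_independence[OF coset_rep_in_coset _ N.a_subgroup] by simp

lemma coset_rep_eq_iff:
  assumes "v \<in> carrier P" "w \<in> carrier P"
  shows "coset_rep P N v = coset_rep P N w \<longleftrightarrow> N +>\<^bsub>P\<^esub> v = N +>\<^bsub>P\<^esub> w"
  using coset_rep_coset assms by (metis coset_rep_def)

lemma coset_rep_eq_zero_iff:
  assumes "v \<in> carrier P"
  shows "coset_rep P N v = \<zero>\<^bsub>rep_quotient P N\<^esub> \<longleftrightarrow> v \<in> N"
proof -
  have "coset_rep P N v = \<zero>\<^bsub>rep_quotient P N\<^esub> \<longleftrightarrow> N +>\<^bsub>P\<^esub> v = N"
    using coset_rep_eq_iff[OF assms P.zero_closed] P.a_coset_add_zero[OF N.a_subset]
    by (simp add: rep_quotient_def)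
  also have "\<dots> \<longleftrightarrow> v \<in> N"
    using P.a_coset_join1[OF _ assms N.a_subgroup] P.a_coset_join2[OF assms N.a_subgroup] by blast
  finally show ?thesis .
qed

lemma linear_map_coset_rep: "linear_map R P (rep_quotient P N) (coset_rep P N)"
proof (rule linear_mapI)
  fix x assume x: "x \<in> carrier P"
  note x' = coset_rep_closed[OF x]
  show "coset_rep P N x \<in> carrier (rep_quotient P N)" using x by (simp add: rep_quotient_def)
  show "coset_rep P N (a \<odot>\<^bsub>P\<^esub> x) = a \<odot>\<^bsub>rep_quotient P N\<^esub> coset_rep P N x"
    if a: "a \<in> carrier R" for a
  proof -
    obtain n where n: "n \<in> N" "coset_rep P N x = n \<oplus>\<^bsub>P\<^esub> x"
      using coset_rep_in_coset[OF x] by (auto simp: a_r_coset_def')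
    then have "a \<odot>\<^bsub>P\<^esub> coset_rep P N x = a \<odot>\<^bsub>P\<^esub> n \<oplus>\<^bsub>P\<^esub> a \<odot>\<^bsub>P\<^esub> x"
      using a x N.a_subset by (simp add: P.smult_r_distr subsetD)
    then have "a \<odot>\<^bsub>P\<^esub> coset_rep P N x \<in> N +>\<^bsub>P\<^esub> (a \<odot>\<^bsub>P\<^esub> x)"
      using P.a_rcosI[OF submodule.smult_closed[OF N a n(1)] N.a_subset] a x by simp
    then have "coset_rep P N (a \<odot>\<^bsub>P\<^esub> x) = coset_rep P N (a \<odot>\<^bsub>P\<^esub> coset_rep P N x)"
      using P.a_repr_independence[OF _ _ N.a_subgroup] a x x' by (simp add: coset_rep_eq_iff)
    then show ?thesis by (simp add: rep_quotient_def)
  qed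
  fix y assume y: "y \<in> carrier P"
  note y' = coset_rep_closed[OF y]
  have "coset_rep P N (x \<oplus>\<^bsub>P\<^esub> y) = coset_rep P N (coset_rep P N x \<oplus>\<^bsub>P\<^esub> coset_rep P N y)"
    using x y x' y' by (simp add: coset_rep_eq_iff coset_rep_coset flip: N.a_rcos_sum)
  then show "coset_rep P N (x \<oplus>\<^bsub>P\<^esub> y) = coset_rep P N x \<oplus>\<^bsub>rep_quotient P N\<^esub> coset_rep P N y"
    by (simp add: rep_quotient_def)
qed

lemma coset_rep_surj: "coset_rep P N ` carrier P = carrier (rep_quotient P N)"
  by (simp add: rep_quotient_def)

lemma module_rep_quotient: "module R (rep_quotient P N)"
  by (rule module_of_surj_linear_map[OF P.module_axioms linear_map_coset_rep coset_rep_surj])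
    (simp add: rep_quotient_def)

lemma lin_kernel_coset_rep: "lin_kernel P (rep_quotient P N) (coset_rep P N) = N"
  using coset_rep_eq_zero_iff N.a_subset by (auto simp: lin_kernel_def)

context
  fixes Q :: "('a, 'q) module" and h
  assumes Q: "module R Q" and h: "linear_map R P Q h" and h_zero: "\<And>n. n \<in> N \<Longrightarrow> h n = \<zero>\<^bsub>Q\<^esub>"
begin

lemma quotient_lift_coset_rep:
  assumes "v \<in> carrier P"
  shows "h (coset_rep P N v) = h v"
proof -
  interpret Q: module R Q by (rule Q)
  obtain n where n: "n \<in> N" "coset_rep P N v = n \<oplus>\<^bsub>P\<^esub> v"
    using coset_rep_in_coset[OF assms] by (auto simp: a_r_coset_def')
  then show ?thesis
    using linear_map_add[OF h] linear_map_closed[OF h assms] h_zero N.a_subset assms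
    by (simp add: subsetD)
qed

lemma linear_map_quotient_lift: "linear_map R (rep_quotient P N) Q h"
proof (rule linear_mapI)
  have closed: "x \<in> carrier P" if "x \<in> carrier (rep_quotient P N)" for x
    using that coset_rep_closed by (auto simp: rep_quotient_def)
  fix x assume "x \<in> carrier (rep_quotient P N)"
  note x = closed[OF this]
  show "h x \<in> carrier Q" using linear_map_closed[OF h x] .
  show "h (a \<odot>\<^bsub>rep_quotient P N\<^esub> x) = a \<odot>\<^bsub>Q\<^esub> h x" if "a \<in> carrier R" for a
    using that x linear_map_smult[OF h] by (simp add: rep_quotient_def quotient_lift_coset_rep)
  fix y assume "y \<in> carrier (rep_quotient P N)"
  note y = closed[OF this]
  show "h (x \<oplus>\<^bsub>rep_quotient P N\<^esub> y) = h x \<oplus>\<^bsub>Q\<^esub> h y"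
    using x y linear_map_add[OF h] by (simp add: rep_quotient_def quotient_lift_coset_rep)
qed

end

end

lemma retraction_of_section:
  assumes E: "module R E" and Y: "module R Y" and F: "module R F"
    and i: "linear_map R E Y i" and inj: "inj_on i (carrier E)" and p: "linear_map R Y F p"
    and exact: "i ` carrier E = lin_kernel Y F p"
    and s: "linear_map R F Y s" and split: "\<And>y. y \<in> carrier F \<Longrightarrow> p (s y) = y"
  shows "\<exists>t. linear_map R Y E t \<and> (\<forall>e\<in>carrier E. t (i e) = e)"
proof -
  interpret E: module R E by fact
  interpret Y: module R Y by fact
  interpret F: module R F by fact
  define h where "h x = x \<ominus>\<^bsub>Y\<^esub> s (p x)" for x
  have h: "linear_map R Y Y h"
    unfolding h_def
    by (intro linear_map_diff Y linear_map_compose[OF p s] linear_mapI) simp_all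
  have "p (h x) = \<zero>\<^bsub>F\<^esub>" if x: "x \<in> carrier Y" for x
  proof -
    have px: "p x \<in> carrier F" "s (p x) \<in> carrier Y"
      using linear_map_closed[OF p x] linear_map_closed[OF s] by auto
    then have "p (h x) = p x \<oplus>\<^bsub>F\<^esub> \<ominus>\<^bsub>F\<^esub> p (s (p x))"
      using x linear_map_add[OF p] linear_map_neg[OF Y F p] by (simp add: h_def Y.minus_eq)
    then show ?thesis using px split by (simp add: F.r_neg)
  qed
  then have h_range: "h x \<in> i ` carrier E" if "x \<in> carrier Y" for x
    using that linear_map_closed[OF h that] unfolding exact lin_kernel_def by blast
  define t where "t x = inv_into (carrier E) i (h x)" for x
  have t: "t x \<in> carrier E" "i (t x) = h x" if "x \<in> carrier Y" for x
    using h_range[OF that] unfolding t_def by (auto intro: inv_into_into f_inv_into_f)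
  have t_eqI: "t x = e" if "x \<in> carrier Y" "e \<in> carrier E" "h x = i e" for x e
    using inj_onD[OF inj, of "t x" e] t[OF that(1)] that by simp
  have "linear_map R Y E t"
    using t linear_mapD(2,3)[OF h] linear_mapD(2,3)[OF i] by (intro linear_mapI t_eqI) auto
  moreover have "t (i e) = e" if e: "e \<in> carrier E" for e
  proof (rule t_eqI)
    have "p (i e) = \<zero>\<^bsub>F\<^esub>" using e exact by (auto simp: lin_kernel_def)
    then show "h (i e) = i e"
      using linear_map_closed[OF i e] linear_map_zero[OF F Y s] by (simp add: h_def Y.minus_eq)
  qed (use linear_map_closed[OF i e] e in auto)
  ultimately show ?thesis by blast
qed

locale pushout =
  K: module R K + P: module R P + E: module R E
  for R :: "'a ring" and K :: "('a, 'k) module" and P :: "('a, 'p) module"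
    and E :: "('a, 'e) module" +
  fixes d :: "'k \<Rightarrow> 'p" and \<phi> :: "'k \<Rightarrow> 'e"
  assumes d: "linear_map R K P d" and \<phi>: "linear_map R K E \<phi>"
    and ker: "\<lbrakk>w \<in> carrier K; d w = \<zero>\<^bsub>P\<^esub>\<rbrakk> \<Longrightarrow> \<phi> w = \<zero>\<^bsub>E\<^esub>"
begin

definition relations :: "('e \<times> 'p) set" where
  "relations = (\<lambda>w. (\<phi> w, \<ominus>\<^bsub>P\<^esub> d w)) ` carrier K"

abbreviation "cokernel \<equiv> rep_quotient P (d ` carrier K)"
abbreviation "coker_map \<equiv> coset_rep P (d ` carrier K)"
abbreviation "pushout_module \<equiv> rep_quotient (prod_module E P) relations"
abbreviation "pushout_map \<equiv> coset_rep (prod_module E P) relations"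

lemma module_EP: "module R (prod_module E P)"
  by (rule module_prod_module[OF E.module_axioms P.module_axioms])

lemma submodule_relations: "submodule relations R (prod_module E P)"
  unfolding relations_def
proof (rule submodule_linear_image[OF K.module_axioms module_EP linear_map_pair[OF \<phi>]])
  have "linear_map R K P (\<lambda>w. \<zero>\<^bsub>P\<^esub> \<ominus>\<^bsub>P\<^esub> d w)"
    by (intro linear_map_diff[OF P.module_axioms _ d] linear_mapI) simp_all
  then show "linear_map R K P (\<lambda>w. \<ominus>\<^bsub>P\<^esub> d w)"
    using linear_map_closed[OF d] by (simp add: P.minus_eq linear_map_def)
qed

sublocale coker: module_quotient R P "d ` carrier K"
  by (intro module_quotient.intro module_quotient_axioms.intro P.module_axioms
      submodule_linear_image K.module_axioms d)

sublocale push: module_quotient R "prod_module E P" relations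
  by (intro module_quotient.intro module_quotient_axioms.intro module_EP submodule_relations)

definition incl :: "'e \<Rightarrow> 'e \<times> 'p" where
  "incl e = pushout_map (e, \<zero>\<^bsub>P\<^esub>)"

definition proj :: "'e \<times> 'p \<Rightarrow> 'p" where
  "proj x = coker_map (snd x)"

lemma linear_map_incl: "linear_map R E pushout_module incl"
  unfolding incl_def
  by (rule linear_map_compose[OF linear_map_pair push.linear_map_coset_rep])
    (auto intro: linear_mapI)

lemma inj_on_incl: "inj_on incl (carrier E)"
proof -
  interpret incl: abelian_group_hom E pushout_module incl
    by (rule linear_map_abelian_group_hom[OF E.module_axioms push.module_rep_quotient
          linear_map_incl])
  have "e = \<zero>\<^bsub>E\<^esub>" if e: "e \<in> carrier E" "incl e = \<zero>\<^bsub>pushout_module\<^esub>" for e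
  proof -
    have "(e, \<zero>\<^bsub>P\<^esub>) \<in> relations"
      using push.coset_rep_eq_zero_iff[of "(e, \<zero>\<^bsub>P\<^esub>)"] e by (simp add: incl_def)
    then obtain w where w: "w \<in> carrier K" "e = \<phi> w" "\<ominus>\<^bsub>P\<^esub> d w = \<zero>\<^bsub>P\<^esub>"
      by (auto simp: relations_def)
    then have "d w = \<zero>\<^bsub>P\<^esub>" using linear_map_closed[OF d w(1)] P.M.minus_minus[of "d w"] by simp
    then show ?thesis using ker w by simp
  qed
  then show ?thesis
    using group_hom.inj_on_one_iff[OF incl.a_group_hom] by simp
qed

lemma
  shows linear_map_proj: "linear_map R pushout_module cokernel proj"
    and proj_pushout_map: "u \<in> carrier (prod_module E P) \<Longrightarrow> proj (pushout_map u) = coker_map (snd u)"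
proof -
  have lin: "linear_map R (prod_module E P) cokernel proj"
    unfolding proj_def by (rule linear_map_compose[OF linear_map_snd coker.linear_map_coset_rep])
  have "proj n = \<zero>\<^bsub>cokernel\<^esub>" if "n \<in> relations" for n
    using that linear_map_closed[OF d] submodule.smult_closed P.submoduleE(3)[OF coker.N]
    by (auto simp: relations_def proj_def coker.coset_rep_eq_zero_iff)
  note lift = coker.module_rep_quotient lin this
  show "linear_map R pushout_module cokernel proj"
    by (rule push.linear_map_quotient_lift[OF lift])
  show "u \<in> carrier (prod_module E P) \<Longrightarrow> proj (pushout_map u) = coker_map (snd u)"
    using push.quotient_lift_coset_rep[OF lift] by (simp add: proj_def)
qed

lemma proj_surj: "proj ` carrier pushout_module = carrier cokernel"
proof -
  have "proj ` carrier pushout_module = (\<lambda>u. coker_map (snd u)) ` carrier (prod_module E P)"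
    using proj_pushout_map by (simp add: image_image flip: push.coset_rep_surj)
  also have "\<dots> = coker_map ` snd ` (carrier E \<times> carrier P)"
    unfolding prod_module_simps image_image ..
  also have "snd ` (carrier E \<times> carrier P) = carrier P"
    using E.zero_closed by (auto simp: snd_image_times)
  finally show ?thesis by (simp only: coker.coset_rep_surj)
qed

lemma pushout_square:
  assumes w: "w \<in> carrier K"
  shows "pushout_map (\<zero>\<^bsub>E\<^esub>, d w) = incl (\<phi> w)"
proof -
  have dw: "d w \<in> carrier P" and \<phi>w: "\<phi> w \<in> carrier E"
    using linear_map_closed[OF d w] linear_map_closed[OF \<phi> w] by auto
  have "(\<phi> w, \<ominus>\<^bsub>P\<^esub> d w) \<in> relations" using w by (auto simp: relations_def)
  then have "(\<phi> w, \<zero>\<^bsub>P\<^esub>) \<in> relations +>\<^bsub>prod_module E P\<^esub> (\<zero>\<^bsub>E\<^esub>, d w)"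
    using dw \<phi>w by (force simp: a_r_coset_def' P.l_neg)
  then have "relations +>\<^bsub>prod_module E P\<^esub> (\<zero>\<^bsub>E\<^esub>, d w) = relations +>\<^bsub>prod_module E P\<^esub> (\<phi> w, \<zero>\<^bsub>P\<^esub>)"
    using dw by (intro push.P.a_repr_independence submodule.axioms(1)[OF submodule_relations]) auto
  then show ?thesis
    using dw \<phi>w by (simp add: incl_def push.coset_rep_eq_iff)
qed

lemma range_incl_eq_kernel_proj: "incl ` carrier E = lin_kernel pushout_module cokernel proj"
proof
  have "proj (incl e) = \<zero>\<^bsub>cokernel\<^esub>" if "e \<in> carrier E" for e
    using that proj_pushout_map[of "(e, \<zero>\<^bsub>P\<^esub>)"]
      linear_map_zero[OF P.module_axioms coker.module_rep_quotient coker.linear_map_coset_rep]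
    by (simp add: incl_def)
  then show "incl ` carrier E \<subseteq> lin_kernel pushout_module cokernel proj"
    using linear_map_closed[OF linear_map_incl] by (auto simp: lin_kernel_def)
  show "lin_kernel pushout_module cokernel proj \<subseteq> incl ` carrier E"
  proof
    fix x assume "x \<in> lin_kernel pushout_module cokernel proj"
    then have "x \<in> carrier pushout_module" and px: "proj x = \<zero>\<^bsub>cokernel\<^esub>"
      by (auto simp: lin_kernel_def)
    then obtain e v where x: "x = pushout_map (e, v)" and e: "e \<in> carrier E" and v: "v \<in> carrier P"
      unfolding push.coset_rep_surj[symmetric] by auto
    have "v \<in> d ` carrier K"
      using px proj_pushout_map[of "(e, v)"] e v coker.coset_rep_eq_zero_iff[OF v] x by simp
    then obtain w where w: "w \<in> carrier K" "v = d w" by blast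
    have \<phi>w: "\<phi> w \<in> carrier E" using linear_map_closed[OF \<phi> w(1)] .
    have "x = pushout_map ((e, \<zero>\<^bsub>P\<^esub>) \<oplus>\<^bsub>prod_module E P\<^esub> (\<zero>\<^bsub>E\<^esub>, d w))"
      using x e v w(2) by simp
    also have "\<dots> = incl e \<oplus>\<^bsub>pushout_module\<^esub> pushout_map (\<zero>\<^bsub>E\<^esub>, d w)"
      unfolding incl_def using e v w(2) by (intro linear_map_add[OF push.linear_map_coset_rep]) auto
    also have "\<dots> = incl (e \<oplus>\<^bsub>E\<^esub> \<phi> w)"
      using linear_map_add[OF linear_map_incl e \<phi>w] by (simp add: pushout_square[OF w(1)])
    finally show "x \<in> incl ` carrier E" using e \<phi>w by blast
  qed
qed

lemma Ext1_vanishes_imp_extends: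
  assumes "Ext1_vanishes R cokernel E"
  shows "\<exists>z. linear_map R P E z \<and> (\<forall>w\<in>carrier K. z (d w) = \<phi> w)"
proof -
  obtain s where s: "linear_map R cokernel pushout_module s"
    "\<And>y. y \<in> carrier cokernel \<Longrightarrow> proj (s y) = y"
    using assms push.module_rep_quotient linear_map_incl inj_on_incl linear_map_proj proj_surj
      range_incl_eq_kernel_proj unfolding Ext1_vanishes_def by blast
  then obtain t where t: "linear_map R pushout_module E t" "\<And>e. e \<in> carrier E \<Longrightarrow> t (incl e) = e"
    using retraction_of_section[OF E.module_axioms push.module_rep_quotient
        coker.module_rep_quotient linear_map_incl inj_on_incl linear_map_proj
        range_incl_eq_kernel_proj] by blast
  have "linear_map R P (prod_module E P) (\<lambda>v. (\<zero>\<^bsub>E\<^esub>, v))"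
    by (intro linear_map_pair linear_mapI) simp_all
  from linear_map_compose[OF linear_map_compose[OF this push.linear_map_coset_rep] t(1)]
  have "linear_map R P E (\<lambda>v. t (pushout_map (\<zero>\<^bsub>E\<^esub>, v)))" .
  moreover have "t (pushout_map (\<zero>\<^bsub>E\<^esub>, d w)) = \<phi> w" if "w \<in> carrier K" for w
    using t(2) linear_map_closed[OF \<phi> that] by (simp add: pushout_square[OF that])
  ultimately show ?thesis by blast
qed

end

section \<open>Duality over self fp-injective rings\<close>

context plain_cring
begin

lemma module_free_module: "module R (free_module R k)"
  unfolding free_module_eq_vec_module by (rule module_vec_module)

lemma finitely_presented_cokernel:
  assumes "linear_map R (free_module R k) (free_module R l) d"
  shows "finitely_presented R (rep_quotient (free_module R l) (d ` carrier (free_module R k)))"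
proof -
  let ?D = "d ` carrier (free_module R k)"
  interpret module_quotient R "free_module R l" ?D
    by (intro module_quotient.intro module_quotient_axioms.intro module_free_module
        submodule_linear_image assms)
  show ?thesis
    unfolding finitely_presented_def has_partial_resolution_def
    using assms linear_map_coset_rep coset_rep_surj lin_kernel_coset_rep
    by (intro exI[of _ "\<lambda>i. if i = 0 then l else k"] exI[of _ "coset_rep (free_module R l) ?D"]
        exI[of _ "\<lambda>_. d"]) simp
qed

lemma fp_injective_extends:
  fixes E :: "('a, 'e) module"
  assumes inj: "fp_injective R E" and E: "module R E"
    and d: "linear_map R (free_module R k) (free_module R l) d"
    and \<phi>: "linear_map R (free_module R k) E \<phi>"
    and ker: "\<And>w. \<lbrakk>w \<in> carrier (free_module R k); d w = \<zero>\<^bsub>free_module R l\<^esub>\<rbrakk> \<Longrightarrow> \<phi> w = \<zero>\<^bsub>E\<^esub>"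
  shows "\<exists>z. linear_map R (free_module R l) E z \<and> (\<forall>w\<in>carrier (free_module R k). z (d w) = \<phi> w)"
proof -
  interpret pushout R "free_module R k" "free_module R l" E d \<phi>
    by (intro pushout.intro pushout_axioms.intro module_free_module E d \<phi> ker)
  have "Ext1_vanishes R cokernel E"
    using inj finitely_presented_cokernel[OF d] coker.module_rep_quotient
    unfolding fp_injective_def by blast
  then show ?thesis by (rule Ext1_vanishes_imp_extends)
qed

lemma orthogonal_to_kernel_imp_in_row_space:
  assumes inj: "self_fp_injective R"
    and A: "\<And>i j. \<lbrakk>i < l; j < m\<rbrakk> \<Longrightarrow> A i j \<in> carrier R"
    and x: "x \<in> carrier (free_module R m)"
    and orthogonal: "\<And>w.
      w \<in> lin_kernel (free_module R m) (free_module R l) (mat_map {..<l} {..<m} A) \<Longrightarrow>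
      dot {..<m} x w = \<zero>"
  shows "x \<in> mat_map {..<m} {..<l} (\<lambda>j i. A i j) ` carrier (free_module R l)"
proof -
  let ?A = "mat_map {..<l} {..<m} A" and ?At = "mat_map {..<m} {..<l} (\<lambda>j i. A i j)"
  note x' = x[unfolded free_module_eq_vec_module]
  have lin_A: "linear_map R (free_module R m) (free_module R l) ?A"
    and lin_At: "linear_map R (free_module R l) (free_module R m) ?At"
    unfolding free_module_eq_vec_module using A by (auto intro!: linear_map_mat_map)
  have "linear_map R (free_module R m) (self_module R) (dot {..<m} x)"
    unfolding free_module_eq_vec_module using vec_closed[OF x'] by (intro linear_map_dot) auto
  then have "\<exists>z. linear_map R (free_module R l) (self_module R) z \<and>
      (\<forall>w\<in>carrier (free_module R m). z (?A w) = dot {..<m} x w)"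
    using orthogonal inj
    by (intro fp_injective_extends module_self_module lin_A)
      (simp_all add: self_fp_injective_def lin_kernel_def)
  then obtain z where z: "linear_map R (free_module R l) (self_module R) z"
    and z_A: "\<And>w. w \<in> carrier (free_module R m) \<Longrightarrow> z (?A w) = dot {..<m} x w" by blast
  obtain c where c: "c \<in> carrier (free_module R l)"
    and z_dot: "\<And>u. u \<in> carrier (free_module R l) \<Longrightarrow> z u = dot {..<l} c u"
    using linear_functional_representable[OF z[unfolded free_module_eq_vec_module]]
    unfolding free_module_eq_vec_module by blast
  have "x = ?At c"
  proof (rule vec_eqI_dot[OF finite_lessThan x'])
    show "?At c \<in> carrier (vec_module R {..<m})"
      using linear_map_closed[OF lin_At c] by (simp add: free_module_eq_vec_module)
    fix w assume w: "w \<in> carrier (vec_module R {..<m})"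
    then have "dot {..<m} x w = dot {..<l} c (?A w)"
      using z_A[of w] z_dot linear_map_closed[OF lin_A, of w]
      by (simp add: free_module_eq_vec_module)
    also have "\<dots> = dot {..<m} (?At c) w"
      using A c w by (intro dot_mat_map_transpose) (auto simp: free_module_eq_vec_module)
    finally show "dot {..<m} x w = dot {..<m} (?At c) w" .
  qed
  then show ?thesis using c by blast
qed

lemma mat_map_transpose_exact:
  assumes inj: "self_fp_injective R"
    and A: "\<And>i j. \<lbrakk>i < l; j < m\<rbrakk> \<Longrightarrow> A i j \<in> carrier R"
    and B: "\<And>j k. \<lbrakk>j < m; k < n\<rbrakk> \<Longrightarrow> B j k \<in> carrier R"
    and exact: "mat_map {..<m} {..<n} B ` carrier (free_module R n) =
      lin_kernel (free_module R m) (free_module R l) (mat_map {..<l} {..<m} A)"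
  shows "mat_map {..<m} {..<l} (\<lambda>j i. A i j) ` carrier (free_module R l) =
    lin_kernel (free_module R m) (free_module R n) (mat_map {..<n} {..<m} (\<lambda>k j. B j k))"
    (is "?At ` _ = lin_kernel _ _ ?Bt")
proof
  let ?A = "mat_map {..<l} {..<m} A" and ?B = "mat_map {..<m} {..<n} B"
  note exact_vec = exact[unfolded free_module_eq_vec_module]
  have "?A (?B y) = (\<lambda>i. \<zero>)" if "y \<in> carrier (vec_module R {..<n})" for y
    using exact_vec that by (auto simp: lin_kernel_def)
  then have "?Bt (?At c) = (\<lambda>k. \<zero>)" if "c \<in> carrier (vec_module R {..<l})" for c
    using that
    by (intro mat_map_transpose_compose_zero[of "{..<l}" "{..<m}" "{..<n}"]) (simp_all add: A B)
  moreover have "linear_map R (vec_module R {..<l}) (vec_module R {..<m}) ?At"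
    using A by (auto intro!: linear_map_mat_map)
  ultimately show "?At ` carrier (free_module R l) \<subseteq>
      lin_kernel (free_module R m) (free_module R n) ?Bt"
    by (auto simp: lin_kernel_def free_module_eq_vec_module linear_map_closed)
  show "lin_kernel (free_module R m) (free_module R n) ?Bt \<subseteq> ?At ` carrier (free_module R l)"
  proof
    fix x assume "x \<in> lin_kernel (free_module R m) (free_module R n) ?Bt"
    then have x: "x \<in> carrier (vec_module R {..<m})" and Bt_x: "?Bt x = (\<lambda>k. \<zero>)"
      by (simp_all add: lin_kernel_def free_module_eq_vec_module)
    have "dot {..<m} x (?B y) = \<zero>" if y: "y \<in> carrier (vec_module R {..<n})" for y
    proof -
      have "dot {..<m} x (?B y) = dot {..<n} (?Bt x) y"
        using B x y by (intro dot_mat_map_transpose) auto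
      then show ?thesis using vec_closed[OF y] by (simp add: Bt_x dot_zero)
    qed
    then show "x \<in> ?At ` carrier (free_module R l)"
      using x A
      by (intro orthogonal_to_kernel_imp_in_row_space[OF inj])
         (auto simp: free_module_eq_vec_module simp flip: exact_vec)
  qed
qed

section \<open>Extending partial resolutions\<close>

lemma one_in_fg_ideal_mat_kernel_transpose:
  assumes arith: "arithmetic_ring R" and "finite I" "finite J"
    and A: "\<And>i j. \<lbrakk>i \<in> I; j \<in> J\<rbrakk> \<Longrightarrow> A i j \<in> carrier R"
    and fg: "\<one> \<in> fg_ideal R (mat_kernel J I (\<lambda>j i. A i j))"
  shows "\<one> \<in> fg_ideal R (mat_kernel I J A)"
proof (rule one_in_fg_idealI_maximal)
  show "module R (mat_kernel I J A)"
    using assms(3) A by (rule module_mat_kernel)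
  fix P assume P: "maximalideal P R"
  have prime: "primeideal P R" by (rule maximalideal_prime[OF P])
  have "fg_at P (mat_kernel J I (\<lambda>j i. A i j))"
    by (rule one_in_fg_ideal_imp_fg_at[OF prime fg])
  then show "fg_at P (mat_kernel I J A)"
    using fg_at_mat_kernel_transpose_iff[where A = A, OF prime locally_dvd_linear[OF arith P]
        assms(2,3) A] by blast
qed

lemma next_syzygy_finitely_generated:
  assumes arith: "arithmetic_ring R" and inj: "self_fp_injective R"
    and d1: "linear_map R (free_module R m) (free_module R l) d1"
    and d2: "linear_map R (free_module R n) (free_module R m) d2"
    and exact: "d2 ` carrier (free_module R n) = lin_kernel (free_module R m) (free_module R l) d1"
  shows "\<exists>k f. linear_map R (free_module R k) (free_module R n) f \<and>
    f ` carrier (free_module R k) = lin_kernel (free_module R n) (free_module R m) d2"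
proof -
  obtain A where A: "\<forall>i<l. \<forall>j<m. A i j \<in> carrier R"
    and d1_eq: "\<forall>x\<in>carrier (free_module R m). d1 x = mat_map {..<l} {..<m} A x"
    using linear_map_has_matrix[OF d1[unfolded free_module_eq_vec_module]]
    unfolding free_module_eq_vec_module by auto
  obtain B where B: "\<forall>j<m. \<forall>k<n. B j k \<in> carrier R"
    and d2_eq: "\<forall>x\<in>carrier (free_module R n). d2 x = mat_map {..<m} {..<n} B x"
    using linear_map_has_matrix[OF d2[unfolded free_module_eq_vec_module]]
    unfolding free_module_eq_vec_module by auto
  let ?At = "mat_map {..<m} {..<l} (\<lambda>j i. A i j)" and ?B = "mat_map {..<m} {..<n} B"
    and ?Bt = "mat_map {..<n} {..<m} (\<lambda>k j. B j k)"
  have lin_At: "linear_map R (free_module R l) (free_module R m) ?At"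
    and lin_B: "linear_map R (free_module R n) (free_module R m) ?B"
    and lin_Bt: "linear_map R (free_module R m) (free_module R n) ?Bt"
    unfolding free_module_eq_vec_module using A B by (auto intro!: linear_map_mat_map)
  have exact_AB: "?B ` carrier (free_module R n) =
      lin_kernel (free_module R m) (free_module R l) (mat_map {..<l} {..<m} A)"
    using exact d1_eq d2_eq
    by (simp add: lin_kernel_def cong: image_cong conj_cong)
  have "?At ` carrier (free_module R l) = lin_kernel (free_module R m) (free_module R n) ?Bt"
    using A B by (intro mat_map_transpose_exact[OF inj _ _ exact_AB]) simp_all
  then have "\<one> \<in> fg_ideal R (kernel_module (free_module R m) (free_module R n) ?Bt)"
    unfolding one_in_fg_ideal_kernel_iff[OF module_free_module module_free_module lin_Bt]
    using lin_At by blast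
  then have "\<one> \<in> fg_ideal R (kernel_module (free_module R n) (free_module R m) ?B)"
    unfolding free_module_eq_vec_module
    by (rule one_in_fg_ideal_mat_kernel_transpose[OF arith finite_lessThan finite_lessThan,
          rotated]) (simp add: B)
  moreover have "lin_kernel (free_module R n) (free_module R m) ?B =
      lin_kernel (free_module R n) (free_module R m) d2"
    using d2_eq by (simp add: lin_kernel_def cong: conj_cong)
  ultimately show ?thesis
    unfolding one_in_fg_ideal_kernel_iff[OF module_free_module module_free_module lin_B] by simp
qed

lemma has_partial_resolution_Suc:
  assumes arith: "arithmetic_ring R" and inj: "self_fp_injective R"
    and n: "n \<ge> 2" and res: "has_partial_resolution R E n"
  shows "has_partial_resolution R E (Suc n)"
proof -
  obtain k d0 d where d0: "linear_map R (free_module R (k 0)) E d0"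
      "d0 ` carrier (free_module R (k 0)) = carrier E"
    and d_all: "\<forall>i\<in>{1..n}. linear_map R (free_module R (k i)) (free_module R (k (i - 1))) (d i)"
    and exact_0: "1 \<le> n \<longrightarrow>
      d 1 ` carrier (free_module R (k 1)) = lin_kernel (free_module R (k 0)) E d0"
    and exact_all: "\<forall>i\<in>{1..<n}. d (i + 1) ` carrier (free_module R (k (i + 1))) =
      lin_kernel (free_module R (k i)) (free_module R (k (i - 1))) (d i)"
    using res unfolding has_partial_resolution_def by (elim exE conjE)
  note d = bspec[OF d_all] and exact = bspec[OF exact_all]
  have pred: "n - 1 \<in> {1..n}" "n - 1 \<in> {1..<n}" "n \<in> {1..n}" "n - 1 + 1 = n" using n by auto
  obtain m f where f: "linear_map R (free_module R m) (free_module R (k n)) f"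
    and exact_f: "f ` carrier (free_module R m) =
      lin_kernel (free_module R (k n)) (free_module R (k (n - 1))) (d n)"
    using next_syzygy_finitely_generated[OF arith inj d[OF pred(1)] d[OF pred(3)]]
      exact[OF pred(2)] pred(4) by auto
  let ?k = "k(Suc n := m)" and ?d = "d(Suc n := f)"
  have "linear_map R (free_module R (?k i)) (free_module R (?k (i - 1))) (?d i)"
    if "i \<in> {1..Suc n}" for i
    using that d[of i] f by (cases "i = Suc n") auto
  moreover have "?d (i + 1) ` carrier (free_module R (?k (i + 1))) =
      lin_kernel (free_module R (?k i)) (free_module R (?k (i - 1))) (?d i)"
    if "i \<in> {1..<Suc n}" for i
    using that exact[of i] exact_f by (cases "i = n") auto
  moreover have "?d 1 ` carrier (free_module R (?k 1)) = lin_kernel (free_module R (?k 0)) E d0"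
    using exact_0 n by simp
  ultimately show ?thesis
    unfolding has_partial_resolution_def
    by (intro exI[of _ ?k] exI[of _ d0] exI[of _ ?d]) (use d0 in \<open>simp del: fun_upd_apply, simp\<close>)
qed

end

lemma lambda_inv_geD:
  assumes "lambda_inv R E \<ge> ereal (real n)"
  shows "\<exists>m\<ge>n. has_partial_resolution R E m"
proof (rule ccontr)
  assume "\<not> ?thesis"
  then have "m < n" if "has_partial_resolution R E m" for m
    using that not_le by blast
  then have "ereal (real m) \<le> ereal (real n - 1)" if "has_partial_resolution R E m" for m
    using that by fastforce
  moreover have "- 1 \<le> ereal (real n - 1)" by (simp add: one_ereal_def)
  ultimately have "lambda_inv R E \<le> ereal (real n - 1)"
    unfolding lambda_inv_def by (intro Sup_least) blast
  with assms have "ereal (real n) \<le> ereal (real n - 1)" by (rule order_trans)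
  then show False by simp
qed

lemma lambda_inv_eq_infinityI:
  assumes "\<And>n. \<exists>m\<ge>n. has_partial_resolution R E m"
  shows "lambda_inv R E = \<infinity>"
proof (rule ereal_top)
  fix b :: real
  obtain n where "b \<le> real n" using real_arch_simple by blast
  moreover obtain m where m: "m \<ge> n" "has_partial_resolution R E m" using assms by blast
  ultimately have "ereal b \<le> ereal (real m)" by simp
  also have "\<dots> \<le> lambda_inv R E"
    unfolding lambda_inv_def using m(2) by (intro Sup_upper) blast
  finally show "ereal b \<le> lambda_inv R E" .
qed

theorem theorem2p4:
  fixes R :: "'a ring" and E :: "('a, 'm) module"
  assumes "cring R"
    and "arithmetic_ring R"
    and "self_fp_injective R"
    and "module R E"
    and "lambda_inv R E \<ge> 2"
  shows "lambda_inv R E = \<infinity>"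
proof -
  interpret plain_cring R by (rule plain_cring.intro) fact
  obtain n where n: "n \<ge> 2" "has_partial_resolution R E n"
    using lambda_inv_geD[of 2 R E] assms(5) by auto
  have "has_partial_resolution R E m" if "n \<le> m" for m
    using that n(1)
  proof (induction rule: dec_induct)
    case base
    show ?case by (rule n(2))
  next
    case (step m)
    then show ?case using has_partial_resolution_Suc[OF assms(2,3) _ step.IH] by simp
  qed
  then show ?thesis
    by (intro lambda_inv_eq_infinityI) (metis nat_le_linear)
qed

end
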